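(* Let $\Omega\subset\mathbb{R}^3$ be a bounded Lipschitz domain, let $\mathbf{j}_s\in L^2(\Omega)^3$, and let $\mathbb{V}$ be a closed subspace of $H(\operatorname{curl};\Omega)$ such that $\|\mathbf{v}\|_{L^2(\Omega)}\le c_5\|\operatorname{curl}\mathbf{v}\|_{L^2(\Omega)}$ for all $\mathbf{v}\in\mathbb{V}$. Let $w(\mathbf{B};\mathbf{J}_p)$ be an energy density satisfying the conditions (i)–(iii) listed in the context with constants $0<c_1\le c_2$, and define $$F(\mathbf{A})=\int_\Omega w(\operatorname{curl}\mathbf{A};\mathbf{J}_p)-\mathbf{j}_s\cdot\mathbf{A}\,dx,\qquad \mathbf{A}\in\mathbb{V}.$$ Fix line-search parameters $0<\sigma<\tfrac12$ and $0<\rho<1$. For each $n\ge0$ let $\mathbb{S}^n:\Omega\to\mathbb{R}^{3\times3}$ be a measurable matrix field such that, for a.e. $x\in\Omega$, $\mathbb{S}^n(x)$ is symmetric and positive definite with all eigenvalues in $[c_3,c_4]$, where $0<c_3\le c_4$ are independent of $n$ and $x$. Given $\mathbf{A}^0\in\mathbb{V}$, define for $n\ge0$ $$\mathbf{A}^{n+1}=\mathbf{A}^n+\alpha^n\,\delta\mathbf{A}^n,$$ where $\delta\mathbf{A}^n\in\mathbb{V}$ is the solution of $$\int_\Omega\mathbb{S}^n\operatorname{curl}\delta\mathbf{A}^n\cdot\operatorname{curl}\mathbf{v}\,dx=\int_\Omega\mathbf{j}_s\cdot\mathbf{v}-\nabla_{\mathbf{B}}w(\operatorname{curl}\mathbf{A}^n;\mathbf{J}_p)\cdot\operatorname{curl}\mathbf{v}\,dx\qquad\forall\,\mathbf{v}\in\mathbb{V},$$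 and $$\alpha^n=\max\{\alpha=\rho^m:\ \Phi_n(\alpha)\le\Phi_n(0)+\sigma\alpha\,\Phi_n'(0),\ m\in\mathbb{Z},\ m\ge0\},\qquad \Phi_n(\alpha)=F(\mathbf{A}^n+\alpha\,\delta\mathbf{A}^n).$$ Then for any $\mathbf{A}^0\in\mathbb{V}$ the iterates $\mathbf{A}^n$ converge to the unique solution $\mathbf{A}\in\mathbb{V}$ of the minimization problem $\min_{\mathbf{A}\in\mathbb{V}}F(\mathbf{A})$ at a linear rate, i.e., there are a constant $C>0$ and a contraction factor $q\in(0,1)$ such that $$\|\operatorname{curl}(\mathbf{A}^n-\mathbf{A})\|_{L^2(\Omega)}\le C\,q^n\,\|\operatorname{curl}(\mathbf{A}^0-\mathbf{A})\|_{L^2(\Omega)}\qquad\text{for all } n\ge0,$$ and (for fixed line-search parameters $\sigma,\rho$) the contraction factor $q$ depends only on the constants $c_1,\dots,c_5$.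
   Context: All spaces are real. $H(\operatorname{curl};\Omega)=\{\mathbf{v}\in L^2(\Omega)^3:\operatorname{curl}\mathbf{v}\in L^2(\Omega)^3\}$ with the usual graph norm. The subspace $\mathbb{V}$ may be infinite-dimensional or finite-dimensional (e.g. a finite element space). The energy density $w(\mathbf{B};\mathbf{J}_p)$ is a real-valued function of $\mathbf{B}\in\mathbb{R}^3$ which depends on $x\in\Omega$ through the given internal state $\mathbf{J}_p=\mathbf{J}_p(x)$ (and possibly through the material at $x$); it is measurable in $x$, and $x\mapsto w(0;\mathbf{J}_p(x))$ is in $L^1(\Omega)$ and $x\mapsto\nabla_{\mathbf{B}}w(0;\mathbf{J}_p(x))$ is in $L^2(\Omega)^3$, so that $F$ is well-defined. The conditions on $w$ are, for a.e. $x\in\Omega$: (i) $\mathbf{B}\mapsto w(\mathbf{B};\mathbf{J}_p)$ is continuously differentiable on $\mathbb{R}^3$; (ii) for all $\mathbf{B},\mathbf{B}'\in\mathbb{R}^3$, $$\langle\nabla_{\mathbf{B}}w(\mathbf{B};\mathbf{J}_p)-\nabla_{\mathbf{B}}w(\mathbf{B}';\mathbf{J}_p),\mathbf{B}-\mathbf{B}'\rangle\ge\tfrac{1}{c_2}|\mathbf{B}-\mathbf{B}'|^2,\qquad|\nabla_{\mathbf{B}}w(\mathbf{B};\mathbf{J}_p)-\nabla_{\mathbf{B}}w(\mathbf{B}';\mathbf{J}_p)|\le\tfrac{1}{c_1}|\mathbf{B}-\mathbf{B}'|,$$ with constants $0<c_1\le c_2$ independent of $x$; (iii) $\mathbf{B}\mapsto\nabla_{\mathbf{B}}w(\mathbf{B};\mathbf{J}_p)$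 is semi-smooth (in the usual sense for locally Lipschitz maps, with respect to Clarke's generalized Jacobian). *)

theory Defs
  imports "HOL-Analysis.Analysis"
begin

section \<open>Bounded Lipschitz domains\<close>

text \<open>Near every boundary point, and after a rigid motion, the set is the strict subgraph of a
  Lipschitz function of the first two coordinates.  That the boundary is locally the graph of
  \<open>\<gamma>\<close> then follows from the continuity of \<open>\<gamma>\<close>.\<close>

definition lipschitz_boundary :: "(real^3) set \<Rightarrow> bool" where
  "lipschitz_boundary \<Omega> \<longleftrightarrow>
     (\<forall>p\<in>frontier \<Omega>. \<exists>(T :: real^3 \<Rightarrow> real^3) (\<gamma> :: real^2 \<Rightarrow> real) L r.
        orthogonal_transformation T \<and> L-lipschitz_on UNIV \<gamma> \<and> 0 < r \<and>
        (\<forall>y\<in>ball 0 r. p + T y \<in> \<Omega> \<longleftrightarrow> y$3 < \<gamma> (vector [y$1, y$2])))"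

definition bounded_lipschitz_domain :: "(real^3) set \<Rightarrow> bool" where
  "bounded_lipschitz_domain \<Omega> \<longleftrightarrow>
     \<Omega> \<noteq> {} \<and> open \<Omega> \<and> connected \<Omega> \<and> bounded \<Omega> \<and> lipschitz_boundary \<Omega>"


section \<open>Square-integrable fields and the space H(curl)\<close>

text \<open>Elements of the function spaces are represented by functions on the whole space; only their
  values almost everywhere on \<open>\<Omega>\<close> matter.\<close>

definition L2_fields :: "(real^3) set \<Rightarrow> (real^3 \<Rightarrow> real^3) set" where
  "L2_fields \<Omega> = {v. v \<in> borel_measurable (lebesgue_on \<Omega>) \<and>
                      integrable (lebesgue_on \<Omega>) (\<lambda>x. (norm (v x))\<^sup>2)}"

definition L2_norm :: "(real^3) set \<Rightarrow> (real^3 \<Rightarrow> real^3) \<Rightarrow> real" where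
  "L2_norm \<Omega> v = sqrt (LINT x|lebesgue_on \<Omega>. (norm (v x))\<^sup>2)"

definition pderivative :: "3 \<Rightarrow> (real^3 \<Rightarrow> 'b::real_normed_vector) \<Rightarrow> real^3 \<Rightarrow> 'b" where
  "pderivative i f x = frechet_derivative f (at x) (axis i 1)"

primrec C_k :: "nat \<Rightarrow> (real^3 \<Rightarrow> 'b::real_normed_vector) \<Rightarrow> bool" where
  "C_k 0 f \<longleftrightarrow> continuous_on UNIV f"
| "C_k (Suc k) f \<longleftrightarrow> (\<forall>x. f differentiable (at x)) \<and> (\<forall>i. C_k k (pderivative i f))"

definition test_fields :: "(real^3) set \<Rightarrow> (real^3 \<Rightarrow> real^3) set" where
  "test_fields \<Omega> = {\<phi>. (\<forall>k. C_k k \<phi>) \<and> compact (closure {x. \<phi> x \<noteq> 0}) \<and>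
                        closure {x. \<phi> x \<noteq> 0} \<subseteq> \<Omega>}"

definition classical_curl :: "(real^3 \<Rightarrow> real^3) \<Rightarrow> real^3 \<Rightarrow> real^3" where
  "classical_curl \<phi> x = vector
     [pderivative 2 \<phi> x $ 3 - pderivative 3 \<phi> x $ 2,
      pderivative 3 \<phi> x $ 1 - pderivative 1 \<phi> x $ 3,
      pderivative 1 \<phi> x $ 2 - pderivative 2 \<phi> x $ 1]"

definition has_weak_curl :: "(real^3) set \<Rightarrow> (real^3 \<Rightarrow> real^3) \<Rightarrow> (real^3 \<Rightarrow> real^3) \<Rightarrow> bool" where
  "has_weak_curl \<Omega> v g \<longleftrightarrow>
     (\<forall>\<phi>\<in>test_fields \<Omega>. (LINT x|lebesgue_on \<Omega>. g x \<bullet> \<phi> x)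
                           = (LINT x|lebesgue_on \<Omega>. v x \<bullet> classical_curl \<phi> x))"

definition H_curl :: "(real^3) set \<Rightarrow> (real^3 \<Rightarrow> real^3) set" where
  "H_curl \<Omega> = {v \<in> L2_fields \<Omega>. \<exists>g\<in>L2_fields \<Omega>. has_weak_curl \<Omega> v g}"

text \<open>A representative of the weak curl, which is unique up to null sets on \<open>H_curl \<Omega>\<close>.\<close>

definition curl :: "(real^3) set \<Rightarrow> (real^3 \<Rightarrow> real^3) \<Rightarrow> real^3 \<Rightarrow> real^3" where
  "curl \<Omega> v = (SOME g. g \<in> L2_fields \<Omega> \<and> has_weak_curl \<Omega> v g)"

definition H_curl_norm :: "(real^3) set \<Rightarrow> (real^3 \<Rightarrow> real^3) \<Rightarrow> real" where
  "H_curl_norm \<Omega> v = sqrt ((L2_norm \<Omega> v)\<^sup>2 + (L2_norm \<Omega> (curl \<Omega> v))\<^sup>2)"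

text \<open>The closedness clause, applied to constant sequences, makes \<open>V\<close> invariant under changes of
  its elements on null sets.\<close>

definition closed_subspace_H_curl :: "(real^3) set \<Rightarrow> (real^3 \<Rightarrow> real^3) set \<Rightarrow> bool" where
  "closed_subspace_H_curl \<Omega> V \<longleftrightarrow>
     V \<subseteq> H_curl \<Omega> \<and> (\<lambda>x. 0) \<in> V \<and>
     (\<forall>u\<in>V. \<forall>v\<in>V. (\<lambda>x. u x + v x) \<in> V) \<and>
     (\<forall>a. \<forall>v\<in>V. (\<lambda>x. a *\<^sub>R v x) \<in> V) \<and>
     (\<forall>u v. (\<forall>n::nat. u n \<in> V) \<and> v \<in> H_curl \<Omega> \<and>
            (\<lambda>n. H_curl_norm \<Omega> (\<lambda>x. u n x - v x)) \<longlonglongrightarrow> 0 \<longrightarrow> v \<in> V)"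


section \<open>Gradients, Clarke's generalized Jacobian and semismoothness\<close>

definition gradient :: "(real^3 \<Rightarrow> real) \<Rightarrow> real^3 \<Rightarrow> real^3" where
  "gradient f x = (THE D. GDERIV f x :> D)"

definition C1_function :: "(real^3 \<Rightarrow> real) \<Rightarrow> bool" where
  "C1_function f \<longleftrightarrow> (\<forall>x. \<exists>D. GDERIV f x :> D) \<and> continuous_on UNIV (gradient f)"

definition clarke_jacobian :: "(real^3 \<Rightarrow> real^3) \<Rightarrow> real^3 \<Rightarrow> (real^3^3) set" where
  "clarke_jacobian G x = convex hull
     {J. \<exists>y. (\<forall>k::nat. G differentiable (at (y k))) \<and> y \<longlonglongrightarrow> x \<and>
             (\<lambda>k. jacobian G (at (y k))) \<longlonglongrightarrow> J}"

text \<open>Semismoothness in the sense of Qi and Sun: \<open>G\<close> is Lipschitz near \<open>x\<close>, and for every \<open>h\<close> the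
  limit of \<open>J h'\<close> over \<open>J \<in> clarke_jacobian G (x + t h')\<close>, \<open>h' \<rightarrow> h\<close>, \<open>t \<rightarrow> 0+\<close> exists.\<close>

definition semismooth_at :: "(real^3 \<Rightarrow> real^3) \<Rightarrow> real^3 \<Rightarrow> bool" where
  "semismooth_at G x \<longleftrightarrow>
     (\<exists>r>0. \<exists>L. L-lipschitz_on (ball x r) G) \<and>
     (\<forall>h. \<exists>l. \<forall>\<epsilon>>0. \<exists>\<delta>>0. \<forall>t h' J.
        0 < t \<and> t < \<delta> \<and> dist h' h < \<delta> \<and> J \<in> clarke_jacobian G (x + t *\<^sub>R h')
        \<longrightarrow> dist (J *v h') l < \<epsilon>)"


section \<open>Energy densities\<close>

text \<open>An energy density is a function \<open>w\<close> of the point \<open>x\<close> (the material), the field \<open>B\<close> and the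
  internal state \<open>Jp x\<close>.  Since \<open>w\<close> may depend on \<open>x\<close> explicitly, letting the state take values
  in \<open>\<real>\<^sup>3\<close> is no restriction.\<close>

type_synonym density = "real^3 \<Rightarrow> real^3 \<Rightarrow> real^3 \<Rightarrow> real"

definition grad_B :: "density \<Rightarrow> (real^3 \<Rightarrow> real^3) \<Rightarrow> real^3 \<Rightarrow> real^3 \<Rightarrow> real^3" where
  "grad_B w Jp x = gradient (\<lambda>B. w x B (Jp x))"

definition energy_density ::
  "(real^3) set \<Rightarrow> density \<Rightarrow> (real^3 \<Rightarrow> real^3) \<Rightarrow> real \<Rightarrow> real \<Rightarrow> bool" where
  "energy_density \<Omega> w Jp c1 c2 \<longleftrightarrow>
     (\<forall>B. (\<lambda>x. w x B (Jp x)) \<in> borel_measurable (lebesgue_on \<Omega>)) \<and>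
     integrable (lebesgue_on \<Omega>) (\<lambda>x. w x 0 (Jp x)) \<and>
     (\<lambda>x. grad_B w Jp x 0) \<in> L2_fields \<Omega> \<and>
     (AE x in lebesgue_on \<Omega>.
        C1_function (\<lambda>B. w x B (Jp x)) \<and>
        (\<forall>B B'. (grad_B w Jp x B - grad_B w Jp x B') \<bullet> (B - B') \<ge> 1 / c2 * (norm (B - B'))\<^sup>2 \<and>
                norm (grad_B w Jp x B - grad_B w Jp x B') \<le> 1 / c1 * norm (B - B')) \<and>
        (\<forall>B. semismooth_at (grad_B w Jp x) B))"

definition energy ::
  "(real^3) set \<Rightarrow> density \<Rightarrow> (real^3 \<Rightarrow> real^3) \<Rightarrow> (real^3 \<Rightarrow> real^3) \<Rightarrow> (real^3 \<Rightarrow> real^3) \<Rightarrow> real" where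
  "energy \<Omega> w Jp js A = (LINT x|lebesgue_on \<Omega>. w x (curl \<Omega> A x) (Jp x) - js x \<bullet> A x)"

definition is_minimizer :: "((real^3 \<Rightarrow> real^3) \<Rightarrow> real) \<Rightarrow> (real^3 \<Rightarrow> real^3) set \<Rightarrow> (real^3 \<Rightarrow> real^3) \<Rightarrow> bool" where
  "is_minimizer F V A \<longleftrightarrow> A \<in> V \<and> (\<forall>B\<in>V. F A \<le> F B)"


section \<open>The iterative scheme\<close>

definition is_eigenvalue :: "real^3^3 \<Rightarrow> real \<Rightarrow> bool" where
  "is_eigenvalue M l \<longleftrightarrow> (\<exists>v. v \<noteq> 0 \<and> M *v v = l *\<^sub>R v)"

definition symmetric_positive_definite :: "real^3^3 \<Rightarrow> bool" where
  "symmetric_positive_definite M \<longleftrightarrow> transpose M = M \<and> (\<forall>v. v \<noteq> 0 \<longrightarrow> 0 < v \<bullet> (M *v v))"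

definition admissible_matrix_field ::
  "(real^3) set \<Rightarrow> real \<Rightarrow> real \<Rightarrow> (real^3 \<Rightarrow> real^3^3) \<Rightarrow> bool" where
  "admissible_matrix_field \<Omega> c3 c4 S \<longleftrightarrow>
     S \<in> borel_measurable (lebesgue_on \<Omega>) \<and>
     (AE x in lebesgue_on \<Omega>. symmetric_positive_definite (S x) \<and>
        (\<forall>l. is_eigenvalue (S x) l \<longrightarrow> c3 \<le> l \<and> l \<le> c4))"

definition is_search_direction ::
  "(real^3) set \<Rightarrow> (real^3 \<Rightarrow> real^3) set \<Rightarrow> density \<Rightarrow> (real^3 \<Rightarrow> real^3) \<Rightarrow> (real^3 \<Rightarrow> real^3) \<Rightarrow>
   (real^3 \<Rightarrow> real^3^3) \<Rightarrow> (real^3 \<Rightarrow> real^3) \<Rightarrow> (real^3 \<Rightarrow> real^3) \<Rightarrow> bool" where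
  "is_search_direction \<Omega> V w Jp js S A d \<longleftrightarrow>
     d \<in> V \<and>
     (\<forall>v\<in>V. (LINT x|lebesgue_on \<Omega>. (S x *v curl \<Omega> d x) \<bullet> curl \<Omega> v x)
            = (LINT x|lebesgue_on \<Omega>. js x \<bullet> v x - grad_B w Jp x (curl \<Omega> A x) \<bullet> curl \<Omega> v x))"

definition armijo_step :: "real \<Rightarrow> real \<Rightarrow> (real \<Rightarrow> real) \<Rightarrow> real" where
  "armijo_step \<sigma> \<rho> \<Phi> =
     (GREATEST \<alpha>. (\<exists>m::nat. \<alpha> = \<rho> ^ m) \<and> \<Phi> \<alpha> \<le> \<Phi> 0 + \<sigma> * \<alpha> * deriv \<Phi> 0)"

definition is_iteration ::
  "(real^3) set \<Rightarrow> (real^3 \<Rightarrow> real^3) set \<Rightarrow> density \<Rightarrow> (real^3 \<Rightarrow> real^3) \<Rightarrow> (real^3 \<Rightarrow> real^3) \<Rightarrow>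
   (nat \<Rightarrow> real^3 \<Rightarrow> real^3^3) \<Rightarrow> real \<Rightarrow> real \<Rightarrow> (real^3 \<Rightarrow> real^3) \<Rightarrow> (nat \<Rightarrow> real^3 \<Rightarrow> real^3) \<Rightarrow> bool" where
  "is_iteration \<Omega> V w Jp js S \<sigma> \<rho> A0 A \<longleftrightarrow>
     A 0 = A0 \<and>
     (\<forall>n. \<exists>d. is_search_direction \<Omega> V w Jp js (S n) (A n) d \<and>
        A (Suc n) = (\<lambda>x. A n x +
          armijo_step \<sigma> \<rho> (\<lambda>\<alpha>. energy \<Omega> w Jp js (\<lambda>x. A n x + \<alpha> *\<^sub>R d x)) *\<^sub>R d x))"

end

theory Submission
  imports Defs
begin

text \<open>Write \<open>F'(A)\<close> for the first variation of the energy and \<open>\<parallel>\<cdot>\<parallel>\<close> for the norm of the curl.  The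
  conditions on the density give \<open>1/(2 c2) \<parallel>B - A\<parallel>\<^sup>2 \<le> F B - F A - F'(A) (B - A) \<le> 1/(2 c1) \<parallel>B - A\<parallel>\<^sup>2\<close>,
  and the convergence only uses this inequality.  Let \<open>d\<close> be the search direction at \<open>A\<close> and
  \<open>Q = \<integral> S curl d \<bullet> curl d = - F'(A) d\<close>.  The upper bound and \<open>c3 \<parallel>d\<parallel>\<^sup>2 \<le> Q\<close> show that every step of
  length at most \<open>2 (1 - \<sigma>) c1 c3\<close> is accepted, so the energy decreases by a fixed multiple of \<open>Q\<close>.
  The lower bound and Young's inequality show that the energy gap at \<open>A\<close> is at most \<open>c2 c4 / 2\<close> times \<open>Q\<close>.
  Hence the gap contracts by a fixed factor, and it is equivalent to the squared distance to the
  minimizer.  The minimizer exists since minimizing sequences are Cauchy; applied to a quadratic density,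
  the same argument solves the equation for the search direction.\<close>


section \<open>Square-integrable fields\<close>

text \<open>Fields are functions rather than classes modulo null sets, and \<open>curl\<close> picks
  one weak curl among many, so even the linearity of \<open>curl\<close> holds only almost
  everywhere and rests on the uniqueness of weak curls. Uniqueness needs a supply of smooth
  compactly supported fields, which are built from exp(-c/t). That minimizing sequences are Cauchy
  helps only because V is complete in the curl norm: the Poincare inequality makes the fields
  themselves Cauchy in L2, and weak curls pass to L2 limits. The convex theory is developed for an
  abstract density with monotonicity constant m and Lipschitz constant L, used with (m, L) = (1/c2,
  1/c1) for the energy and (c3, c4) for the direction equation. The Young weight is c4/m, so that
  the term m/2 |e|^2 in the distance e to the minimizer cancels exactly against the lower bound.
  Since the gap is comparable to a squared norm, q is the square root of a bound for the contraction
  factor of the gap, and passing between gap and distance costs only the constant sqrt(c2/c1)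
  outside of q^n.\<close>

lemma complete_lebesgue_on:
  assumes "\<Omega> \<in> sets lebesgue"
  shows "complete_measure (lebesgue_on \<Omega>)"
proof
  fix A B assume "B \<subseteq> A" "A \<in> null_sets (lebesgue_on \<Omega>)"
  then show "B \<in> sets (lebesgue_on \<Omega>)"
    using assms null_sets_restrict_space[OF assms, of A] null_sets_completion_subset[of B A]
    by (auto simp: sets_restrict_space_iff null_sets_def dest: sets.sets_into_space)
qed

text \<open>The preimages under \<open>f\<close> and \<open>g\<close> agree up to a null set, and in
  a complete measure space a set that agrees with a measurable one up to a null set is measurable.
  Fields known only almost everywhere thus remain measurable.\<close>

lemma borel_measurable_lebesgue_on_AE_cong:
  fixes f g :: "'a::euclidean_space \<Rightarrow> 'b::topological_space"
  assumes \<Omega>: "\<Omega> \<in> sets lebesgue"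
    and f: "f \<in> borel_measurable (lebesgue_on \<Omega>)" and ae: "AE x in lebesgue_on \<Omega>. f x = g x"
  shows "g \<in> borel_measurable (lebesgue_on \<Omega>)"
proof -
  interpret complete_measure "lebesgue_on \<Omega>"
    by (rule complete_lebesgue_on[OF \<Omega>])
  show ?thesis
  proof (rule measurableI)
    fix B :: "'b set" assume "B \<in> sets borel"
    then have "f -` B \<inter> space (lebesgue_on \<Omega>) \<in> sets (lebesgue_on \<Omega>)"
      using f by (rule measurable_sets[rotated])
    moreover have "AE x in lebesgue_on \<Omega>. x \<in> f -` B \<inter> space (lebesgue_on \<Omega>)
        \<longleftrightarrow> x \<in> g -` B \<inter> space (lebesgue_on \<Omega>)"
      using ae by eventually_elim auto
    ultimately show "g -` B \<inter> space (lebesgue_on \<Omega>) \<in> sets (lebesgue_on \<Omega>)"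
      using in_sets_AE by blast
  qed auto
qed

lemma L2_fieldsD:
  assumes "u \<in> L2_fields \<Omega>"
  shows "u \<in> borel_measurable (lebesgue_on \<Omega>)" "integrable (lebesgue_on \<Omega>) (\<lambda>x. (norm (u x))\<^sup>2)"
  using assms by (auto simp: L2_fields_def)

lemma L2_fieldsI_bound:
  assumes "u \<in> borel_measurable (lebesgue_on \<Omega>)" "integrable (lebesgue_on \<Omega>) h"
    and "AE x in lebesgue_on \<Omega>. (norm (u x))\<^sup>2 \<le> h x"
  shows "u \<in> L2_fields \<Omega>"
proof -
  have "integrable (lebesgue_on \<Omega>) (\<lambda>x. (norm (u x))\<^sup>2)"
    by (rule Bochner_Integration.integrable_bound[OF assms(2)])
       (use assms in \<open>auto elim: eventually_mono\<close>)
  then show ?thesis using assms by (auto simp: L2_fields_def)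
qed

lemma norm_add_square_le: "(norm (a + b :: 'a::real_inner))\<^sup>2 \<le> 2 * (norm a)\<^sup>2 + 2 * (norm b)\<^sup>2"
proof -
  have "(norm (a + b))\<^sup>2 + (norm (a - b))\<^sup>2 = 2 * (norm a)\<^sup>2 + 2 * (norm b)\<^sup>2"
    by (simp add: power2_norm_eq_inner algebra_simps inner_commute)
  then show ?thesis using zero_le_power2[of "norm (a - b)"] by linarith
qed

lemma L2_fields_zero [simp]: "(\<lambda>x. 0) \<in> L2_fields \<Omega>"
  by (simp add: L2_fields_def)

lemma L2_fields_add [intro]:
  assumes "u \<in> L2_fields \<Omega>" "v \<in> L2_fields \<Omega>"
  shows "(\<lambda>x. u x + v x) \<in> L2_fields \<Omega>"
  using L2_fieldsD[OF assms(1)] L2_fieldsD[OF assms(2)]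
  by (intro L2_fieldsI_bound[where h="\<lambda>x. 2 * (norm (u x))\<^sup>2 + 2 * (norm (v x))\<^sup>2"])
     (auto intro!: norm_add_square_le)

lemma L2_fields_scale [intro]:
  assumes "u \<in> L2_fields \<Omega>"
  shows "(\<lambda>x. a *\<^sub>R u x) \<in> L2_fields \<Omega>"
  using L2_fieldsD[OF assms] by (auto simp: L2_fields_def power_mult_distrib)

lemma L2_fields_diff [intro]:
  assumes "u \<in> L2_fields \<Omega>" "v \<in> L2_fields \<Omega>"
  shows "(\<lambda>x. u x - v x) \<in> L2_fields \<Omega>"
  using L2_fields_add[OF assms(1) L2_fields_scale[OF assms(2), of "-1"]] by simp

lemma L2_fields_AE_cong:
  assumes \<Omega>: "\<Omega> \<in> sets lebesgue"
    and u: "u \<in> L2_fields \<Omega>" and ae: "AE x in lebesgue_on \<Omega>. u x = v x"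
  shows "v \<in> L2_fields \<Omega>"
proof (rule L2_fieldsI_bound)
  show "v \<in> borel_measurable (lebesgue_on \<Omega>)"
    by (rule borel_measurable_lebesgue_on_AE_cong[OF \<Omega> L2_fieldsD(1)[OF u] ae])
  show "AE x in lebesgue_on \<Omega>. (norm (v x))\<^sup>2 \<le> (norm (u x))\<^sup>2"
    using ae by eventually_elim simp
qed (rule L2_fieldsD(2)[OF u])

lemma L2_inner_integrable [intro]:
  assumes "u \<in> L2_fields \<Omega>" "v \<in> L2_fields \<Omega>"
  shows "integrable (lebesgue_on \<Omega>) (\<lambda>x. u x \<bullet> v x)"
proof (rule Bochner_Integration.integrable_bound)
  note uv = L2_fieldsD[OF assms(1)] L2_fieldsD[OF assms(2)]
  show "integrable (lebesgue_on \<Omega>) (\<lambda>x. (norm (u x))\<^sup>2 + (norm (v x))\<^sup>2)"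
    using uv by auto
  show "(\<lambda>x. u x \<bullet> v x) \<in> borel_measurable (lebesgue_on \<Omega>)"
    using uv by auto
  have "\<bar>u x \<bullet> v x\<bar> \<le> (norm (u x))\<^sup>2 + (norm (v x))\<^sup>2" for x
  proof -
    have "\<bar>u x \<bullet> v x\<bar> \<le> norm (u x) * norm (v x)" by (rule Cauchy_Schwarz_ineq2)
    also have "\<dots> \<le> (norm (u x))\<^sup>2 + (norm (v x))\<^sup>2"
      using sum_squares_bound[of "norm (u x)" "norm (v x)"]
        mult_nonneg_nonneg[OF norm_ge_zero[of "u x"] norm_ge_zero[of "v x"]]
      by linarith
    finally show ?thesis .
  qed
  then show "AE x in lebesgue_on \<Omega>. norm (u x \<bullet> v x) \<le> norm ((norm (u x))\<^sup>2 + (norm (v x))\<^sup>2)"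
    by auto
qed

section \<open>The L2 norm, Cauchy--Schwarz and the triangle inequality\<close>

lemma L2_norm_nonneg [simp]: "0 \<le> L2_norm \<Omega> u"
  by (simp add: L2_norm_def)

lemma L2_norm_square: "(L2_norm \<Omega> u)\<^sup>2 = (LINT x|lebesgue_on \<Omega>. (norm (u x))\<^sup>2)"
  by (simp add: L2_norm_def)

lemma L2_norm_scale: "L2_norm \<Omega> (\<lambda>x. a *\<^sub>R u x) = \<bar>a\<bar> * L2_norm \<Omega> u"
  by (simp add: L2_norm_def power_mult_distrib real_sqrt_mult)

lemma L2_norm_minus_commute: "L2_norm \<Omega> (\<lambda>x. u x - v x) = L2_norm \<Omega> (\<lambda>x. v x - u x)"
  by (simp add: L2_norm_def norm_minus_commute)

lemma L2_norm_AE_cong: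
  assumes "\<Omega> \<in> sets lebesgue" "u \<in> L2_fields \<Omega>" "AE x in lebesgue_on \<Omega>. u x = v x"
  shows "L2_norm \<Omega> u = L2_norm \<Omega> v"
proof -
  have "v \<in> L2_fields \<Omega>" by (rule L2_fields_AE_cong[OF assms])
  then have "(LINT x|lebesgue_on \<Omega>. (norm (u x))\<^sup>2) = (LINT x|lebesgue_on \<Omega>. (norm (v x))\<^sup>2)"
    using assms L2_fieldsD[OF assms(2)] L2_fieldsD[of v \<Omega>]
    by (intro integral_cong_AE) (auto elim: eventually_mono)
  then show ?thesis by (simp add: L2_norm_def)
qed

lemma L2_norm_eq_0D:
  assumes "u \<in> L2_fields \<Omega>" "L2_norm \<Omega> u = 0"
  shows "AE x in lebesgue_on \<Omega>. u x = 0"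
proof -
  have "(LINT x|lebesgue_on \<Omega>. (norm (u x))\<^sup>2) = 0"
    using assms(2) L2_norm_square[of \<Omega> u] by simp
  then have "AE x in lebesgue_on \<Omega>. (norm (u x))\<^sup>2 = 0"
    using integral_nonneg_eq_0_iff_AE[OF L2_fieldsD(2)[OF assms(1)]] by simp
  then show ?thesis by simp
qed

lemma L2_norm_square_add_scale:
  assumes "u \<in> L2_fields \<Omega>" "v \<in> L2_fields \<Omega>"
  shows "(L2_norm \<Omega> (\<lambda>x. u x + t *\<^sub>R v x))\<^sup>2
    = (L2_norm \<Omega> u)\<^sup>2 + 2 * t * (LINT x|lebesgue_on \<Omega>. u x \<bullet> v x) + t\<^sup>2 * (L2_norm \<Omega> v)\<^sup>2"
proof -
  have "(norm (u x + t *\<^sub>R v x))\<^sup>2 = (norm (u x))\<^sup>2 + 2 * t * (u x \<bullet> v x) + t\<^sup>2 * (norm (v x))\<^sup>2" for x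
    by (simp only: power2_norm_eq_inner) (simp add: algebra_simps inner_commute power2_eq_square)
  then show ?thesis
    using L2_fieldsD(2)[OF assms(1)] L2_fieldsD(2)[OF assms(2)] L2_inner_integrable[OF assms]
    by (simp add: L2_norm_square)
qed

text \<open>The quadratic t -> |u + t v|^2 in the L2 norm is nonnegative; it is evaluated at its
  minimum t = - I / |v|^2, where I is the integral. If |v| = 0, then v vanishes almost everywhere
  and I is 0.\<close>

lemma L2_Cauchy_Schwarz:
  assumes "u \<in> L2_fields \<Omega>" "v \<in> L2_fields \<Omega>"
  shows "\<bar>LINT x|lebesgue_on \<Omega>. u x \<bullet> v x\<bar> \<le> L2_norm \<Omega> u * L2_norm \<Omega> v"
proof -
  let ?I = "LINT x|lebesgue_on \<Omega>. u x \<bullet> v x"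
  have pos: "0 \<le> (L2_norm \<Omega> u)\<^sup>2 + 2 * t * ?I + t\<^sup>2 * (L2_norm \<Omega> v)\<^sup>2" for t
    using L2_norm_square_add_scale[OF assms, of t] by (metis zero_le_power2)
  have "?I\<^sup>2 \<le> (L2_norm \<Omega> u * L2_norm \<Omega> v)\<^sup>2"
  proof (cases "L2_norm \<Omega> v = 0")
    case True
    then have "AE x in lebesgue_on \<Omega>. v x = 0" by (rule L2_norm_eq_0D[OF assms(2)])
    then have "?I = 0" by (intro integral_eq_zero_AE) (auto elim: eventually_mono)
    then show ?thesis by simp
  next
    case False
    then have n: "0 < (L2_norm \<Omega> v)\<^sup>2" by simp
    have "2 * t * ?I + t\<^sup>2 * N = - (?I\<^sup>2 / N)" if "t = - ?I / N" "0 < N" for t N :: real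
      using that by (simp add: power2_eq_square)
    from this[OF refl n] have "0 \<le> (L2_norm \<Omega> u)\<^sup>2 - ?I\<^sup>2 / (L2_norm \<Omega> v)\<^sup>2"
      using pos[of "- ?I / (L2_norm \<Omega> v)\<^sup>2"] by linarith
    then show ?thesis using n by (simp add: field_simps power_mult_distrib)
  qed
  then show ?thesis
    by (metis abs_le_square_iff abs_of_nonneg mult_nonneg_nonneg L2_norm_nonneg)
qed

lemma L2_norm_triangle:
  assumes "u \<in> L2_fields \<Omega>" "v \<in> L2_fields \<Omega>"
  shows "L2_norm \<Omega> (\<lambda>x. u x + v x) \<le> L2_norm \<Omega> u + L2_norm \<Omega> v"
proof (rule power2_le_imp_le)
  show "(L2_norm \<Omega> (\<lambda>x. u x + v x))\<^sup>2 \<le> (L2_norm \<Omega> u + L2_norm \<Omega> v)\<^sup>2"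
    using L2_norm_square_add_scale[OF assms, of 1] L2_Cauchy_Schwarz[OF assms]
    by (simp add: power2_sum)
qed simp

lemma L2_norm_triangle_diff:
  assumes "u \<in> L2_fields \<Omega>" "v \<in> L2_fields \<Omega>" "z \<in> L2_fields \<Omega>"
  shows "L2_norm \<Omega> (\<lambda>x. u x - z x) \<le> L2_norm \<Omega> (\<lambda>x. u x - v x) + L2_norm \<Omega> (\<lambda>x. v x - z x)"
  using L2_norm_triangle[OF L2_fields_diff[OF assms(1,2)] L2_fields_diff[OF assms(2,3)]] by simp

section \<open>Completeness of L2\<close>

lemma nn_integral_L2:
  assumes "u \<in> L2_fields \<Omega>"
  shows "(\<integral>\<^sup>+x. ennreal ((norm (u x))\<^sup>2) \<partial>lebesgue_on \<Omega>) = ennreal ((L2_norm \<Omega> u)\<^sup>2)"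
  unfolding L2_norm_square by (intro nn_integral_eq_integral L2_fieldsD(2)[OF assms]) auto

text \<open>Riesz--Fischer: a rapidly converging subsequence converges almost everywhere, and Fatou's lemma
  identifies its limit.\<close>

lemma L2_complete:
  assumes fin: "\<Omega> \<in> lmeasurable" and u: "\<And>n::nat. u n \<in> L2_fields \<Omega>"
    and cauchy: "\<And>e. 0 < e \<Longrightarrow> \<exists>N. \<forall>m\<ge>N. \<forall>n\<ge>N. L2_norm \<Omega> (\<lambda>x. u m x - u n x) < e"
  obtains v where "v \<in> L2_fields \<Omega>" "(\<lambda>n. L2_norm \<Omega> (\<lambda>x. u n x - v x)) \<longlonglongrightarrow> 0"
proof -
  let ?M = "lebesgue_on \<Omega>"
  interpret finite_measure ?M by (rule finite_measure_lebesgue_on[OF fin])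
  have um [measurable]: "u n \<in> borel_measurable ?M" for n by (rule L2_fieldsD(1)[OF u])
  have "\<forall>k. \<exists>N. \<forall>m\<ge>N. \<forall>n\<ge>N. L2_norm \<Omega> (\<lambda>x. u m x - u n x) < (1/2)^k"
    using cauchy by simp
  then obtain s where s: "\<And>k m n. s k \<le> m \<Longrightarrow> s k \<le> n \<Longrightarrow> L2_norm \<Omega> (\<lambda>x. u m x - u n x) < (1/2)^k"
    by metis
  \<comment> \<open>Partial sums turn the thresholds \<open>s\<close> into a monotone sequence of
    indices that still dominates them.\<close>
  define r where "r k = (\<Sum>j\<le>k. s j)" for k
  have sr: "s k \<le> r k" for k by (auto simp: r_def intro: member_le_sum)
  have rmono: "r j \<le> r k" if "j \<le> k" for j k
    unfolding r_def using that by (intro sum_mono2) auto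
  have rk: "L2_norm \<Omega> (\<lambda>x. u (r j) x - u (r k) x) \<le> (1/2)^j" if "j \<le> k" for j k
    using s[of j "r j" "r k"] sr[of j] rmono[OF that] by force
  define d where "d k x = norm (u (r (Suc k)) x - u (r k) x)" for k x
  have dm [measurable]: "d k \<in> borel_measurable ?M" for k unfolding d_def by simp
  have d_nonneg: "0 \<le> d k x" for k x by (simp add: d_def)
  \<comment> \<open>By Cauchy--Schwarz against a constant field, the L1 norm is at most
    \<open>c\<close> times the L2 norm, so the increments are summable in L1.\<close>
  define c where "c = sqrt (measure ?M (space ?M))"
  have dint: "integrable ?M (d k) \<and> (LINT x|?M. d k x) \<le> c * (1/2)^k" for k
  proof -
    let ?e = "\<lambda>x. u (r (Suc k)) x - u (r k) x"
    have e: "?e \<in> L2_fields \<Omega>" by (intro L2_fields_diff u)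
    \<comment> \<open>Cauchy--Schwarz is available for vector fields, so the scalar
      \<open>d k\<close> is placed on the first axis.\<close>
    have D: "(\<lambda>x. d k x *\<^sub>R axis 1 1 :: real^3) \<in> L2_fields \<Omega>"
      using L2_fieldsD[OF e] by (auto simp: L2_fields_def d_def norm_axis_1)
    have O: "(\<lambda>x. axis 1 1 :: real^3) \<in> L2_fields \<Omega>"
      by (auto simp: L2_fields_def norm_axis_1)
    have n1: "L2_norm \<Omega> (\<lambda>x. d k x *\<^sub>R axis 1 1 :: real^3) = L2_norm \<Omega> ?e"
      by (simp add: L2_norm_def d_def norm_axis_1)
    have n2: "L2_norm \<Omega> (\<lambda>x. axis 1 1 :: real^3) = c"
      by (simp add: L2_norm_def c_def norm_axis_1)
    have eq: "(\<lambda>x. (d k x *\<^sub>R axis 1 1) \<bullet> (axis 1 1 :: real^3)) = d k"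
      by (auto simp: inner_axis_axis)
    have "(LINT x|?M. d k x) \<le> L2_norm \<Omega> ?e * c"
      using L2_Cauchy_Schwarz[OF D O] unfolding n1 n2 eq by linarith
    also have "\<dots> \<le> (1/2)^k * c"
    proof (rule mult_right_mono)
      show "L2_norm \<Omega> ?e \<le> (1/2)^k"
        using rk[of k "Suc k"] L2_norm_minus_commute[of \<Omega> "u (r (Suc k))" "u (r k)"] by simp
    qed (simp add: c_def)
    finally show ?thesis
      using L2_inner_integrable[OF D O] unfolding eq by (simp add: mult.commute)
  qed
  have "(\<integral>\<^sup>+x. (\<Sum>k. ennreal (d k x)) \<partial>?M) = (\<Sum>k. \<integral>\<^sup>+x. ennreal (d k x) \<partial>?M)"
    by (rule nn_integral_suminf) simp
  also have "\<dots> \<le> (\<Sum>k. ennreal (c * (1/2)^k))"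
  proof (rule suminf_le)
    show "(\<integral>\<^sup>+x. ennreal (d k x) \<partial>?M) \<le> ennreal (c * (1/2)^k)" for k
      using dint[of k] by (subst nn_integral_eq_integral) (auto intro!: ennreal_leI simp: d_nonneg)
  qed auto
  also have "\<dots> = ennreal (\<Sum>k. c * (1/2)^k)"
    by (rule suminf_ennreal2) (auto simp: c_def intro!: summable_mult summable_geometric)
  finally have "(\<integral>\<^sup>+x. (\<Sum>k. ennreal (d k x)) \<partial>?M) \<noteq> \<infinity>"
    by (auto simp: top_unique)
  then have "AE x in ?M. (\<Sum>k. ennreal (d k x)) \<noteq> \<infinity>"
    by (intro nn_integral_PInf_AE) auto
  then have conv: "AE x in ?M. convergent (\<lambda>k. u (r k) x)"
  proof eventually_elim
    case (elim x)
    then have "summable (\<lambda>k. d k x)"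
      by (intro summable_suminf_not_top) (auto simp: d_def)
    then have "summable (\<lambda>k. u (r (Suc k)) x - u (r k) x)"
      unfolding d_def by (rule summable_norm_cancel)
    then have "convergent (\<lambda>n. \<Sum>k<n. u (r (Suc k)) x - u (r k) x)"
      by (simp add: summable_iff_convergent)
    then have "convergent (\<lambda>n. u (r n) x - u (r 0) x)"
      by (simp add: sum_lessThan_telescope[of "\<lambda>k. u (r k) x"])
    then show ?case using convergent_diff_const_right_iff by blast
  qed
  \<comment> \<open>\<open>lim\<close> is total and preserves measurability, so the null set where
    the subsequence diverges needs no separate treatment.\<close>
  define v where "v x = lim (\<lambda>k. u (r k) x)" for x
  have vm [measurable]: "v \<in> borel_measurable ?M" unfolding v_def by simp
  have fatou: "(\<integral>\<^sup>+x. ennreal ((norm (u (r j) x - v x))\<^sup>2) \<partial>?M) \<le> ennreal (((1/2)^j)\<^sup>2)" for j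
  proof -
    have "(\<integral>\<^sup>+x. ennreal ((norm (u (r j) x - v x))\<^sup>2) \<partial>?M)
        = (\<integral>\<^sup>+x. liminf (\<lambda>k. ennreal ((norm (u (r j) x - u (r k) x))\<^sup>2)) \<partial>?M)"
    proof (rule nn_integral_cong_AE, use conv in eventually_elim)
      case (elim x)
      then have "(\<lambda>k. u (r k) x) \<longlonglongrightarrow> v x" by (simp add: v_def convergent_LIMSEQ_iff)
      then have "(\<lambda>k. ennreal ((norm (u (r j) x - u (r k) x))\<^sup>2)) \<longlonglongrightarrow> ennreal ((norm (u (r j) x - v x))\<^sup>2)"
        by (intro tendsto_intros)
      then show ?case by (intro lim_imp_Liminf[symmetric]) auto
    qed
    also have "\<dots> \<le> liminf (\<lambda>k. \<integral>\<^sup>+x. ennreal ((norm (u (r j) x - u (r k) x))\<^sup>2) \<partial>?M)"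
      by (rule nn_integral_liminf) simp
    also have "\<dots> \<le> ennreal (((1/2)^j)\<^sup>2)"
    proof (rule Liminf_le)
      show "\<forall>\<^sub>F k in sequentially. (\<integral>\<^sup>+x. ennreal ((norm (u (r j) x - u (r k) x))\<^sup>2) \<partial>?M)
          \<le> ennreal (((1/2)^j)\<^sup>2)"
        using eventually_ge_at_top[of j]
      proof eventually_elim
        case (elim k)
        show ?case
          using rk[OF elim] by (subst nn_integral_L2) (auto intro!: L2_fields_diff u power_mono ennreal_leI)
      qed
    qed simp
    finally show ?thesis .
  qed
  have uv: "(\<lambda>x. u (r j) x - v x) \<in> L2_fields \<Omega>" for j
    unfolding L2_fields_def
    using fatou[of j] by (auto intro!: integrableI_bounded simp: less_top[symmetric] top_unique
      elim: le_less_trans)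
  have "v = (\<lambda>x. u (r 0) x - (u (r 0) x - v x))" by auto
  with L2_fields_diff[OF u uv] have v: "v \<in> L2_fields \<Omega>" by metis
  have ruv: "L2_norm \<Omega> (\<lambda>x. u (r j) x - v x) \<le> (1/2)^j" for j
    using fatou[of j] unfolding nn_integral_L2[OF uv]
    by (auto simp: ennreal_le_iff power2_le_iff_abs_le)
  have "(\<lambda>n. L2_norm \<Omega> (\<lambda>x. u n x - v x)) \<longlonglongrightarrow> 0"
  proof (rule LIMSEQ_I)
    fix e :: real assume e: "0 < e"
    obtain j where j: "(1/2::real)^j < e/2"
      using real_arch_pow_inv[of "e/2" "1/2"] e by auto
    have "norm (L2_norm \<Omega> (\<lambda>x. u n x - v x) - 0) < e" if "r j \<le> n" for n
      using L2_norm_triangle_diff[OF u[of n] u[of "r j"] v] ruv[of j] s[of j n "r j"] sr[of j] that j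
      by simp
    then show "\<exists>N. \<forall>n\<ge>N. norm (L2_norm \<Omega> (\<lambda>x. u n x - v x) - 0) < e" by blast
  qed
  with v that show thesis by blast
qed


section \<open>Smooth bump functions\<close>

lemma pderivative_eqI:
  assumes "(f has_derivative D) (at x)"
  shows "pderivative i f x = D (axis i 1)"
  using frechet_derivative_at[OF assms] by (simp add: pderivative_def)

text \<open>The recursive definition does not mention lower orders, so monotonicity takes an
  induction; its base is that differentiable functions are continuous. The product rule uses it for
  the factors that are not differentiated.\<close>

lemma C_k_SucD: "C_k (Suc k) f \<Longrightarrow> C_k k f"
proof (induction k arbitrary: f)
  case 0
  then show ?case
    by (auto simp: continuous_on_eq_continuous_at intro: differentiable_imp_continuous_within)
next
  case (Suc k)
  have "C_k k (pderivative i f)" for i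
    using Suc.prems Suc.IH[of "pderivative i f"] by (simp del: C_k.simps(2) add: C_k.simps(2)[of "Suc k" f])
  with Suc.prems show ?case by simp
qed

lemma C_k_const: "C_k k (\<lambda>x. c)"
proof (induction k arbitrary: c)
  case (Suc k)
  have "pderivative i (\<lambda>x. c) = (\<lambda>x. 0)" for i
    by (rule ext, rule pderivative_eqI, rule has_derivative_const)
  with Suc show ?case by simp
qed simp

lemma C_k_add: "C_k k f \<Longrightarrow> C_k k g \<Longrightarrow> C_k k (\<lambda>x. f x + g x)"
proof (induction k arbitrary: f g)
  case 0
  then show ?case by (auto intro: continuous_intros)
next
  case (Suc k)
  have "pderivative i (\<lambda>x. f x + g x) = (\<lambda>x. pderivative i f x + pderivative i g x)" for i
  proof
    fix x
    have "((\<lambda>x. f x + g x) has_derivative (\<lambda>h. frechet_derivative f (at x) h + frechet_derivative g (at x) h)) (at x)"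
      using Suc.prems by (intro has_derivative_add) (auto simp: frechet_derivative_works[symmetric])
    from pderivative_eqI[OF this] show "pderivative i (\<lambda>x. f x + g x) x = pderivative i f x + pderivative i g x"
      by (simp add: pderivative_def)
  qed
  with Suc show ?case by auto
qed

lemma C_k_scaleR: "C_k k f \<Longrightarrow> C_k k g \<Longrightarrow> C_k k (\<lambda>x. f x *\<^sub>R g x)"
proof (induction k arbitrary: f g)
  case 0
  then show ?case by (auto intro: continuous_intros)
next
  case (Suc k)
  have D: "((\<lambda>x. f x *\<^sub>R g x) has_derivative
      (\<lambda>h. f x *\<^sub>R frechet_derivative g (at x) h + frechet_derivative f (at x) h *\<^sub>R g x)) (at x)" for x
    using Suc.prems by (intro has_derivative_scaleR) (auto simp: frechet_derivative_works[symmetric])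
  then have "pderivative i (\<lambda>x. f x *\<^sub>R g x) = (\<lambda>x. f x *\<^sub>R pderivative i g x + pderivative i f x *\<^sub>R g x)" for i
    by (intro ext) (simp add: pderivative_eqI[OF D], simp add: pderivative_def)
  moreover have "C_k k f" "C_k k g"
    using Suc.prems by (auto intro: C_k_SucD simp del: C_k.simps)
  ultimately show ?case
    using Suc D by (auto intro!: C_k_add differentiableI)
qed

lemma C_k_mult: "C_k k f \<Longrightarrow> C_k k g \<Longrightarrow> C_k k (\<lambda>x. f x * g x :: real)"
  using C_k_scaleR[of k f g] by simp

lemma C_k_prod: "(\<And>i. i \<in> I \<Longrightarrow> C_k k (f i)) \<Longrightarrow> C_k k (\<lambda>x. \<Prod>i\<in>I. f i x :: real)"
  by (induction I rule: infinite_finite_induct) (auto intro: C_k_const C_k_mult)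

text \<open>The family \<open>t \<mapsto> p(1/t) exp(-c/t)\<close> is closed under differentiation, which makes its members smooth.\<close>

definition flat :: "real \<Rightarrow> real poly \<Rightarrow> real \<Rightarrow> real" where
  "flat c p t = (if t \<le> 0 then 0 else poly p (1 / t) * exp (- (c / t)))"

text \<open>The exponential dominates each monomial, and a polynomial is a finite sum of those. With
  s = 1/t this is the decay of \<open>flat\<close> at 0 from the right.\<close>

lemma poly_times_exp_tendsto_0:
  assumes "0 < (c::real)"
  shows "((\<lambda>s. poly p s * exp (- (c * s))) \<longlongrightarrow> 0) at_top"
proof -
  have "((\<lambda>s. s ^ n * exp (- (c * s))) \<longlongrightarrow> 0) at_top" for n
  proof -
    have "((\<lambda>s. (c * s) ^ n / exp (c * s)) \<longlongrightarrow> 0) at_top"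
      using assms by (intro filterlim_compose[OF tendsto_power_div_exp_0]
        filterlim_tendsto_pos_mult_at_top[OF tendsto_const _ filterlim_ident])
    then have "((\<lambda>s. (1 / c ^ n) * ((c * s) ^ n / exp (c * s))) \<longlongrightarrow> 0) at_top"
      by (rule tendsto_mult_right_zero)
    then show ?thesis
      using assms by (simp add: power_mult_distrib exp_minus field_simps)
  qed
  then have "((\<lambda>s. \<Sum>i\<le>degree p. coeff p i * (s ^ i * exp (- (c * s)))) \<longlongrightarrow> 0) at_top"
    by (intro tendsto_null_sum tendsto_mult_right_zero) auto
  then show ?thesis
    by (simp add: poly_altdef sum_distrib_right mult.assoc)
qed

text \<open>With s = 1/t the derivative of p(s) exp(-c s) in t is s^2 (c p(s) - p'(s)) exp(-c s);
  the polynomial \<open>[:0, 0, 1:]\<close> is s^2. The delicate point is t = 0.\<close>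

lemma DERIV_flat:
  assumes "0 < c"
  shows "(flat c p has_real_derivative flat c ([:0, 0, 1:] * (smult c p - pderiv p)) t) (at t)"
proof -
  consider "t < 0" | "t = 0" | "0 < t" by linarith
  then show ?thesis
  proof cases
    case 1
    have "(flat c p has_real_derivative 0) (at t)"
      by (rule has_field_derivative_transform_within_open[of "\<lambda>_. 0" _ _ "{..<0}"])
         (use 1 in \<open>auto simp: flat_def\<close>)
    with 1 show ?thesis by (simp add: flat_def)
  next
    case 2
    have "((\<lambda>h. (flat c p h) / h) \<longlongrightarrow> 0) (at 0)"
    proof (rule filterlim_split_at_real)
      show "((\<lambda>h. flat c p h / h) \<longlongrightarrow> 0) (at_left 0)"
        by (rule tendsto_eventually) (auto simp: eventually_at_left[of "-1"] flat_def intro!: exI[of _ "-1"])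
      \<comment> \<open>The right difference quotient at 0 becomes s p(s) exp(-c s) as s tends to
        infinity.\<close>
      have "((\<lambda>s. flat c p (inverse s) / inverse s) \<longlongrightarrow> 0) at_top"
      proof (rule Lim_transform_eventually[OF poly_times_exp_tendsto_0[OF assms, of "[:0, 1:] * p"]])
        show "\<forall>\<^sub>F s in at_top. poly ([:0, 1:] * p) s * exp (- (c * s)) = flat c p (inverse s) / inverse s"
          using eventually_gt_at_top[of 0] by eventually_elim (simp add: flat_def field_simps)
      qed
      then show "((\<lambda>h. flat c p h / h) \<longlongrightarrow> 0) (at_right 0)"
        by (simp add: filterlim_at_right_to_top)
    qed
    with 2 show ?thesis by (simp add: has_field_derivative_iff flat_def)
  next
    case 3
    have "((\<lambda>t. poly p (1 / t) * exp (- (c / t))) has_real_derivative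
        flat c ([:0, 0, 1:] * (smult c p - pderiv p)) t) (at t)"
      using 3 by (auto intro!: derivative_eq_intros DERIV_chain2[OF poly_DERIV]
          simp: flat_def field_simps power2_eq_square)
    then show ?thesis
      by (rule has_field_derivative_transform_within_open[of _ _ _ "{0<..}"])
         (use 3 in \<open>auto simp: flat_def\<close>)
  qed
qed

text \<open>The polynomial changes with each derivative, so it is generalized in the induction. The
  affine argument covers both \<open>x $ i - a $ i\<close> and \<open>b $ i - x $ i\<close> for the
  two faces of a box.\<close>

lemma C_k_flat:
  assumes "0 < c"
  shows "C_k k (\<lambda>x. flat c p (s * x $ i + a))"
proof (induction k arbitrary: p)
  case 0
  have "continuous_on UNIV (flat c p)" for p
    using DERIV_flat[OF assms] by (auto intro!: DERIV_continuous_on)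
  moreover have "continuous_on UNIV (\<lambda>x::real^3. s * x $ i + a)"
    by (intro continuous_intros)
  ultimately show ?case
    by (simp add: continuous_on_compose2[of UNIV "flat c p"])
next
  case (Suc k)
  let ?q = "[:0, 0, 1:] * (smult c p - pderiv p)"
  have D: "((\<lambda>x. flat c p (s * x $ i + a)) has_derivative
      (\<lambda>h. flat c ?q (s * x $ i + a) * (s * h $ i))) (at x)" for x :: "real^3"
  proof -
    have "((\<lambda>x. s * x $ i + a) has_derivative (\<lambda>h. s * h $ i + 0)) (at x)"
      by (intro has_derivative_add has_derivative_mult_right has_derivative_const
          bounded_linear_imp_has_derivative[OF bounded_linear_vec_nth])
    then have "((\<lambda>x. s * x $ i + a) has_derivative (\<lambda>h. s * h $ i)) (at x)"
      by simp
    moreover have "(flat c p has_derivative (*) (flat c ?q (s * x $ i + a))) (at (s * x $ i + a))"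
      using DERIV_flat[OF assms] unfolding has_field_derivative_def .
    ultimately show ?thesis
      by (rule has_derivative_compose)
  qed
  have P: "pderivative j (\<lambda>x. flat c p (s * x $ i + a))
      = (\<lambda>x. flat c ?q (s * x $ i + a) * (s * (axis j 1 :: real^3) $ i))" for j
    by (rule ext, rule pderivative_eqI, rule D)
  show ?case
    unfolding C_k.simps P by (intro conjI allI differentiableI[OF D] C_k_mult Suc.IH C_k_const)
qed

text \<open>For t > 0 each factor exp(-c/t) tends to 1 as c tends to 0, so the bumps tend to the
  indicator of the open box; outside it some factor is 0. The parameter \<open>c\<close> is kept for
  this limit.\<close>

definition box_bump :: "real \<Rightarrow> real^3 \<Rightarrow> real^3 \<Rightarrow> real^3 \<Rightarrow> real" where
  "box_bump c a b x = (\<Prod>i\<in>UNIV. flat c 1 (x $ i - a $ i) * flat c 1 (b $ i - x $ i))"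

lemma C_k_box_bump:
  assumes "0 < c" shows "C_k k (box_bump c a b)"
proof -
  have "C_k k (\<lambda>x. flat c 1 (1 * x $ i + - a $ i) * flat c 1 ((-1) * x $ i + b $ i))" for i
    by (intro C_k_mult C_k_flat assms)
  then have "C_k k (\<lambda>x. \<Prod>i\<in>UNIV. flat c 1 (1 * x $ i + - a $ i) * flat c 1 ((-1) * x $ i + b $ i))"
    by (intro C_k_prod)
  then show ?thesis by (simp add: box_bump_def[abs_def] algebra_simps)
qed

lemma flat_1_bounds: "0 < c \<Longrightarrow> 0 \<le> flat c 1 t \<and> flat c 1 t \<le> 1"
  by (auto simp: flat_def)

lemma box_bump_bounds: "0 < c \<Longrightarrow> 0 \<le> box_bump c a b x \<and> box_bump c a b x \<le> 1"
  unfolding box_bump_def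
  by (intro conjI prod_nonneg prod_le_1 ballI mult_nonneg_nonneg mult_le_one) (auto simp: flat_1_bounds)

lemma box_bump_nonzero_imp: "box_bump c a b x \<noteq> 0 \<Longrightarrow> x \<in> box a b"
  by (auto simp: box_bump_def mem_box_cart flat_def split: if_splits) (meson not_le)+

lemma box_bump_tendsto_indicator:
  "(\<lambda>n. box_bump (1 / real (Suc n)) a b x) \<longlonglongrightarrow> indicator (box a b) x"
proof (cases "x \<in> box a b")
  case True
  have f: "(\<lambda>n. flat (1 / real (Suc n)) 1 t) \<longlonglongrightarrow> 1" if "0 < t" for t
  proof -
    have "(\<lambda>n. exp (- ((1 / real (Suc n)) / t))) \<longlonglongrightarrow> exp (- (0 / t))"
      by (intro tendsto_intros LIMSEQ_Suc[OF lim_1_over_n]) (use that in auto)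
    then show ?thesis using that by (simp add: flat_def)
  qed
  have "(\<lambda>n. box_bump (1 / real (Suc n)) a b x) \<longlonglongrightarrow> (\<Prod>i\<in>(UNIV::3 set). 1 * 1)"
    unfolding box_bump_def by (intro tendsto_intros f) (use True in \<open>auto simp: mem_box_cart\<close>)
  with True show ?thesis by simp
next
  case False
  then have "box_bump c a b x = 0" for c using box_bump_nonzero_imp by blast
  with False show ?thesis by simp
qed

lemma box_bump_test_field:
  assumes "0 < c" "cbox a b \<subseteq> \<Omega>"
  shows "(\<lambda>x. box_bump c a b x *\<^sub>R e) \<in> test_fields \<Omega>"
proof -
  have "{x. box_bump c a b x *\<^sub>R e \<noteq> 0} \<subseteq> cbox a b"
    using box_bump_nonzero_imp box_subset_cbox by fastforce
  then have cl: "closure {x. box_bump c a b x *\<^sub>R e \<noteq> 0} \<subseteq> cbox a b"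
    by (rule closure_minimal) (rule closed_cbox)
  then have "compact (closure {x. box_bump c a b x *\<^sub>R e \<noteq> 0})"
    using compact_cbox bounded_subset compact_eq_bounded_closed by blast
  with cl assms show ?thesis
    by (auto simp: test_fields_def intro!: C_k_scaleR C_k_box_bump C_k_const)
qed


section \<open>Weak curls\<close>

lemma L2_fields_const [simp]:
  assumes "\<Omega> \<in> lmeasurable" shows "(\<lambda>x. c) \<in> L2_fields \<Omega>"
proof -
  interpret finite_measure "lebesgue_on \<Omega>" by (rule finite_measure_lebesgue_on[OF assms])
  show ?thesis by (simp add: L2_fields_def)
qed

text \<open>Box bumps in a fixed direction \<open>e\<close> are test fields. Letting their parameter
  tend to 0, dominated convergence with majorant |g . e| replaces the bump by the indicator of the
  box.\<close>

lemma integral_box_eq_0_if_test_fields: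
  assumes \<Omega>: "\<Omega> \<in> lmeasurable" and g: "g \<in> L2_fields \<Omega>"
    and test: "\<And>\<phi>. \<phi> \<in> test_fields \<Omega> \<Longrightarrow> (LINT x|lebesgue_on \<Omega>. g x \<bullet> \<phi> x) = 0"
    and ab: "cbox a b \<subseteq> \<Omega>"
  shows "(LINT x|lebesgue_on \<Omega>. indicator (box a b) x * (g x \<bullet> e)) = 0"
proof -
  let ?M = "lebesgue_on \<Omega>"
  have \<Omega>s: "\<Omega> \<in> sets lebesgue" using \<Omega> by auto
  have int: "integrable ?M (\<lambda>x. g x \<bullet> e)"
    by (rule L2_inner_integrable[OF g L2_fields_const[OF \<Omega>]])
  have m: "box_bump (1 / real (Suc n)) a b \<in> borel_measurable ?M" for n
    using C_k_box_bump[of "1 / real (Suc n)" 0 a b]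
    by (auto intro!: continuous_imp_measurable_on_sets_lebesgue[OF _ \<Omega>s] elim: continuous_on_subset)
  have zero: "(LINT x|?M. box_bump (1 / real (Suc n)) a b x * (g x \<bullet> e)) = 0" for n
    using test[OF box_bump_test_field[OF _ ab, of "1 / real (Suc n)" e]] by simp
  have "(\<lambda>n. LINT x|?M. box_bump (1 / real (Suc n)) a b x * (g x \<bullet> e))
      \<longlonglongrightarrow> (LINT x|?M. indicator (box a b) x * (g x \<bullet> e))"
  proof (rule integral_dominated_convergence[where w="\<lambda>x. norm (g x \<bullet> e)"])
    have "box a b \<in> sets ?M"
      using box_subset_cbox ab \<Omega>s by (auto simp: sets_restrict_space_iff)
    then show "(\<lambda>x. indicator (box a b) x * (g x \<bullet> e)) \<in> borel_measurable ?M"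
      using int by auto
    show "(\<lambda>x. box_bump (1 / real (Suc n)) a b x * (g x \<bullet> e)) \<in> borel_measurable ?M" for n
      using int m by auto
    show "integrable ?M (\<lambda>x. norm (g x \<bullet> e))"
      using int by auto
    show "AE x in ?M. (\<lambda>n. box_bump (1 / real (Suc n)) a b x * (g x \<bullet> e)) \<longlonglongrightarrow> indicator (box a b) x * (g x \<bullet> e)"
      by (intro AE_I2 tendsto_mult_right box_bump_tendsto_indicator)
    show "AE x in ?M. norm (box_bump (1 / real (Suc n)) a b x * (g x \<bullet> e)) \<le> norm (g x \<bullet> e)" for n
      using box_bump_bounds[of "1 / real (Suc n)" a b]
      by (intro AE_I2) (simp add: abs_mult mult_left_le_one_le)
  qed
  then show ?thesis unfolding zero by (simp add: LIMSEQ_const_iff)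
qed

text \<open>Lebesgue differentiation: almost every value of \<open>f\<close> is the limit of
  averages over shrinking cubes with a corner at that point, and the small ones lie in the open set,
  where the averages vanish.\<close>

lemma AE_eq_0_if_box_integrals_eq_0:
  fixes f :: "'a::euclidean_space \<Rightarrow> real"
  assumes \<Omega>: "open \<Omega>" "\<Omega> \<in> lmeasurable" and f: "integrable (lebesgue_on \<Omega>) f"
    and zero: "\<And>a b. cbox a b \<subseteq> \<Omega> \<Longrightarrow> (LINT x|lebesgue_on \<Omega>. indicator (box a b) x * f x) = 0"
  shows "AE x in lebesgue_on \<Omega>. f x = 0"
proof -
  \<comment> \<open>Extension by zero, since the differentiation theorem speaks of functions on the
    whole space.\<close>
  define F where "F x = indicator \<Omega> x * f x" for x
  have \<Omega>s: "\<Omega> \<in> sets lebesgue" using \<Omega> by auto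
  have F: "integrable lebesgue F"
    using f \<Omega>s by (simp add: integrable_restrict_space F_def[abs_def])
  have FS: "F integrable_on S" if "S \<in> sets lebesgue" for S
    using integrable_mult_indicator[OF that F] that
    by (intro integrable_on_lebesgue_on) (auto simp: integrable_restrict_space)
  have I0: "integral (cbox a b) F = 0" if "cbox a b \<subseteq> \<Omega>" for a b
  proof -
    have "integral (cbox a b) F = integral (box a b) F"
      by (simp add: integral_open_interval)
    also have "\<dots> = (LINT x|lebesgue_on (box a b). F x)"
      by (rule lebesgue_integral_eq_integral[symmetric])
         (use integrable_mult_indicator[OF _ F, of "box a b"] in \<open>auto simp: integrable_restrict_space\<close>)
    also have "\<dots> = (LINT x|lebesgue. indicator (box a b) x * F x)"
      by (simp add: integral_restrict_space)
    also have "\<dots> = (LINT x|lebesgue. indicator \<Omega> x * (indicator (box a b) x * f x))"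
      by (simp add: F_def mult.left_commute)
    also have "\<dots> = (LINT x|lebesgue_on \<Omega>. indicator (box a b) x * f x)"
      using \<Omega>s by (simp add: integral_restrict_space)
    finally show ?thesis using zero[OF that] by simp
  qed
  obtain N where N: "negligible N" and lim: "\<And>x e. x \<notin> N \<Longrightarrow> 0 < e \<Longrightarrow>
      \<exists>d>0. \<forall>h. 0 < h \<and> h < d \<longrightarrow> norm (integral (cbox x (x + h *\<^sub>R One)) F /\<^sub>R h ^ DIM('a) - F x) < e"
    using integrable_ccontinuous_explicit[of F, OF FS[OF fmeasurableD[OF lmeasurable_cbox]]] by blast
  have z: "f x = 0" if x: "x \<in> \<Omega>" "x \<notin> N" for x
  proof (rule ccontr)
    assume nz: "f x \<noteq> 0"
    then have "0 < \<bar>F x\<bar>" using x by (simp add: F_def)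
    with lim[OF x(2)] obtain d where d: "0 < d" and
      dl: "\<And>h. 0 < h \<Longrightarrow> h < d \<Longrightarrow> norm (integral (cbox x (x + h *\<^sub>R One)) F /\<^sub>R h ^ DIM('a) - F x) < \<bar>F x\<bar>"
      by meson
    obtain r where r: "0 < r" "ball x r \<subseteq> \<Omega>" using \<Omega>(1) x(1) openE by blast
    \<comment> \<open>The bound \<open>h < d\<close> serves the differentiation theorem;
      \<open>h * real DIM('a) < r\<close> bounds the l1 distance from the corner and keeps the cube
      in the ball.\<close>
    define h where "h = min (d / 2) (r / (2 * real DIM('a)))"
    have h: "0 < h" "h < d" "h * real DIM('a) < r"
      using d r by (auto simp: h_def min_def field_simps)
    have "cbox x (x + h *\<^sub>R One) \<subseteq> \<Omega>"
    proof
      fix y assume y: "y \<in> cbox x (x + h *\<^sub>R One)"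
      have "norm (y - x) \<le> (\<Sum>b\<in>Basis. \<bar>(y - x) \<bullet> b\<bar>)" by (rule norm_le_l1)
      also have "\<dots> \<le> (\<Sum>b\<in>(Basis::'a set). h)"
        using y by (intro sum_mono) (auto simp: mem_box inner_simps)
      also have "\<dots> < r" using h by (simp add: mult.commute)
      finally show "y \<in> \<Omega>" using r by (auto simp: dist_norm norm_minus_commute)
    qed
    from I0[OF this] dl[OF h(1,2)] show False by simp
  qed
  have "N \<in> null_sets lebesgue" using N by (simp add: negligible_iff_null_sets)
  then have "AE x in lebesgue. x \<notin> N" by (rule AE_not_in)
  then have "AE x in lebesgue. x \<in> \<Omega> \<longrightarrow> f x = 0" by eventually_elim (use z in auto)
  then show ?thesis using \<Omega>s by (simp add: AE_restrict_space_iff)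
qed

text \<open>The fundamental lemma of the calculus of variations, obtained for the three components
  separately.\<close>

lemma AE_eq_0_if_test_fields:
  assumes \<Omega>: "open \<Omega>" "\<Omega> \<in> lmeasurable" and g: "g \<in> L2_fields \<Omega>"
    and test: "\<And>\<phi>. \<phi> \<in> test_fields \<Omega> \<Longrightarrow> (LINT x|lebesgue_on \<Omega>. g x \<bullet> \<phi> x) = 0"
  shows "AE x in lebesgue_on \<Omega>. g x = 0"
proof -
  have "AE x in lebesgue_on \<Omega>. g x \<bullet> axis i 1 = 0" for i
    using \<Omega> L2_inner_integrable[OF g L2_fields_const[OF \<Omega>(2)]] integral_box_eq_0_if_test_fields[OF \<Omega>(2) g test]
    by (rule AE_eq_0_if_box_integrals_eq_0) auto
  then have "AE x in lebesgue_on \<Omega>. \<forall>i. g x \<bullet> axis i 1 = 0"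
    by (simp add: AE_all_countable)
  then show ?thesis
    by eventually_elim (simp add: vec_eq_iff inner_axis)
qed

lemma L2_fields_continuous_compact_support:
  assumes \<Omega>: "\<Omega> \<in> lmeasurable" and f: "continuous_on UNIV f" "compact K" "\<And>x. x \<notin> K \<Longrightarrow> f x = 0"
  shows "f \<in> L2_fields \<Omega>"
proof -
  have "compact (f ` K)"
    using f by (auto intro: compact_continuous_image continuous_on_subset)
  then obtain B where B: "\<And>x. x \<in> K \<Longrightarrow> norm (f x) \<le> B"
    by (meson bounded_iff compact_imp_bounded imageI)
  have "norm (f x) \<le> \<bar>B\<bar>" for x
    using B[of x] f(3)[of x] by (cases "x \<in> K") auto
  then have "(norm (f x))\<^sup>2 \<le> B\<^sup>2" for x
    by (metis abs_le_square_iff abs_norm_cancel)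
  moreover have "integrable (lebesgue_on \<Omega>) (\<lambda>x. B\<^sup>2)"
    by (rule finite_measure.integrable_const[OF finite_measure_lebesgue_on[OF \<Omega>]])
  ultimately show ?thesis
    using \<Omega> f by (intro L2_fieldsI_bound[where h="\<lambda>x. B\<^sup>2"])
      (auto intro!: continuous_imp_measurable_on_sets_lebesgue elim: continuous_on_subset)
qed

text \<open>This makes both pairings in \<open>has_weak_curl\<close> integrals of products of L2
  fields. Additivity of the Bochner integral is available for integrable functions, so every
  manipulation of that identity depends on it.\<close>

lemma test_fields_L2:
  assumes \<Omega>: "\<Omega> \<in> lmeasurable" and \<phi>: "\<phi> \<in> test_fields \<Omega>"
  shows "\<phi> \<in> L2_fields \<Omega>" "classical_curl \<phi> \<in> L2_fields \<Omega>"
proof -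
  let ?K = "closure {x. \<phi> x \<noteq> 0}"
  have K: "compact ?K" and C0: "C_k 0 \<phi>" and C1: "C_k (Suc 0) \<phi>"
    using \<phi> unfolding test_fields_def by blast+
  have out: "\<phi> x = 0" if "x \<notin> ?K" for x
    using that closure_subset[of "{x. \<phi> x \<noteq> 0}"] by blast
  show "\<phi> \<in> L2_fields \<Omega>"
    using C0 by (intro L2_fields_continuous_compact_support[OF \<Omega> _ K out]) simp_all
  have cont: "continuous_on UNIV (pderivative i \<phi>)" for i
    using C1 by simp
  have p0: "pderivative i \<phi> x = 0" if "x \<notin> ?K" for i x
  proof -
    have "(\<phi> has_derivative (\<lambda>h. 0)) (at x)"
    proof (rule has_derivative_transform_within_open[of "\<lambda>x. 0"])
      show "open (- ?K)" by (rule open_Compl[OF closed_closure])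
      show "x \<in> - ?K" using that by blast
      show "0 = \<phi> y" if "y \<in> - ?K" for y using out[of y] that by simp
    qed (rule has_derivative_const)
    then show ?thesis by (rule pderivative_eqI)
  qed
  have "continuous_on UNIV (\<lambda>x. classical_curl \<phi> x $ i)" for i
  proof -
    have "continuous_on UNIV (\<lambda>x. pderivative j \<phi> x $ k - pderivative k' \<phi> x $ l)" for j k k' l
      by (intro continuous_intros cont)
    then show ?thesis
      using exhaust_3[of i] unfolding classical_curl_def by (elim disjE) simp_all
  qed
  then have "continuous_on UNIV (\<lambda>x. \<chi> i. classical_curl \<phi> x $ i)"
    by (rule continuous_on_vec_lambda)
  then have "continuous_on UNIV (classical_curl \<phi>)" by simp
  moreover have "classical_curl \<phi> x = 0" if "x \<notin> ?K" for x
    by (simp add: classical_curl_def p0[OF that] vec_eq_iff forall_3)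
  ultimately show "classical_curl \<phi> \<in> L2_fields \<Omega>"
    by (rule L2_fields_continuous_compact_support[OF \<Omega> _ K])
qed

section \<open>Linearity, uniqueness and closedness of the weak curl\<close>

lemma has_weak_curl_add_scale:
  assumes \<Omega>: "\<Omega> \<in> lmeasurable"
    and "u \<in> L2_fields \<Omega>" "v \<in> L2_fields \<Omega>" "g \<in> L2_fields \<Omega>" "h \<in> L2_fields \<Omega>"
    and "has_weak_curl \<Omega> u g" "has_weak_curl \<Omega> v h"
  shows "has_weak_curl \<Omega> (\<lambda>x. u x + t *\<^sub>R v x) (\<lambda>x. g x + t *\<^sub>R h x)"
  unfolding has_weak_curl_def
proof
  fix \<phi> assume \<phi>: "\<phi> \<in> test_fields \<Omega>"
  note L = test_fields_L2[OF \<Omega> \<phi>]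
  show "(LINT x|lebesgue_on \<Omega>. (g x + t *\<^sub>R h x) \<bullet> \<phi> x)
      = (LINT x|lebesgue_on \<Omega>. (u x + t *\<^sub>R v x) \<bullet> classical_curl \<phi> x)"
    using assms(6,7) \<phi> L2_inner_integrable[OF assms(2) L(2)] L2_inner_integrable[OF assms(3) L(2)]
      L2_inner_integrable[OF assms(4) L(1)] L2_inner_integrable[OF assms(5) L(1)]
    by (simp add: inner_add_left has_weak_curl_def)
qed

lemma has_weak_curl_unique:
  assumes \<Omega>: "open \<Omega>" "\<Omega> \<in> lmeasurable"
    and gh: "g \<in> L2_fields \<Omega>" "h \<in> L2_fields \<Omega>" and "has_weak_curl \<Omega> u g" "has_weak_curl \<Omega> u h"
  shows "AE x in lebesgue_on \<Omega>. g x = h x"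
proof -
  have "AE x in lebesgue_on \<Omega>. g x - h x = 0"
  proof (rule AE_eq_0_if_test_fields[OF \<Omega> L2_fields_diff[OF gh]])
    fix \<phi> assume \<phi>: "\<phi> \<in> test_fields \<Omega>"
    then show "(LINT x|lebesgue_on \<Omega>. (g x - h x) \<bullet> \<phi> x) = 0"
      using assms(5,6) L2_inner_integrable[OF gh(1) test_fields_L2(1)[OF \<Omega>(2) \<phi>]]
        L2_inner_integrable[OF gh(2) test_fields_L2(1)[OF \<Omega>(2) \<phi>]]
      by (simp add: inner_diff_left has_weak_curl_def)
  qed
  then show ?thesis by simp
qed

lemma L2_inner_tendsto:
  assumes "\<And>n::nat. u n \<in> L2_fields \<Omega>" "v \<in> L2_fields \<Omega>" "\<psi> \<in> L2_fields \<Omega>"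
    and lim: "(\<lambda>n. L2_norm \<Omega> (\<lambda>x. u n x - v x)) \<longlonglongrightarrow> 0"
  shows "(\<lambda>n. LINT x|lebesgue_on \<Omega>. u n x \<bullet> \<psi> x) \<longlonglongrightarrow> (LINT x|lebesgue_on \<Omega>. v x \<bullet> \<psi> x)"
proof (rule LIM_zero_cancel, rule Lim_null_comparison)
  show "(\<lambda>n. L2_norm \<Omega> (\<lambda>x. u n x - v x) * L2_norm \<Omega> \<psi>) \<longlonglongrightarrow> 0"
    using tendsto_mult_right[OF lim, of "L2_norm \<Omega> \<psi>"] by simp
  have "(LINT x|lebesgue_on \<Omega>. u n x \<bullet> \<psi> x) - (LINT x|lebesgue_on \<Omega>. v x \<bullet> \<psi> x)
      = (LINT x|lebesgue_on \<Omega>. (u n x - v x) \<bullet> \<psi> x)" for n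
    using L2_inner_integrable[OF assms(1,3)] L2_inner_integrable[OF assms(2,3)]
    by (simp add: inner_diff_left)
  then show "\<forall>\<^sub>F n in sequentially. norm ((LINT x|lebesgue_on \<Omega>. u n x \<bullet> \<psi> x) - (LINT x|lebesgue_on \<Omega>. v x \<bullet> \<psi> x))
      \<le> L2_norm \<Omega> (\<lambda>x. u n x - v x) * L2_norm \<Omega> \<psi>"
    using L2_Cauchy_Schwarz[OF L2_fields_diff[OF assms(1,2)] assms(3)] by simp
qed

text \<open>The weak curl is a closed operator: its identity pairs the fields with fixed L2 fields,
  and such pairings are continuous under L2 convergence.\<close>

lemma has_weak_curl_limit:
  assumes \<Omega>: "\<Omega> \<in> lmeasurable"
    and u: "\<And>n::nat. u n \<in> L2_fields \<Omega>" "\<And>n. g n \<in> L2_fields \<Omega>" "\<And>n. has_weak_curl \<Omega> (u n) (g n)"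
    and v: "v \<in> L2_fields \<Omega>" "h \<in> L2_fields \<Omega>"
    and lim: "(\<lambda>n. L2_norm \<Omega> (\<lambda>x. u n x - v x)) \<longlonglongrightarrow> 0" "(\<lambda>n. L2_norm \<Omega> (\<lambda>x. g n x - h x)) \<longlonglongrightarrow> 0"
  shows "has_weak_curl \<Omega> v h"
  unfolding has_weak_curl_def
proof
  fix \<phi> assume \<phi>: "\<phi> \<in> test_fields \<Omega>"
  note L = test_fields_L2[OF \<Omega> \<phi>]
  have "(\<lambda>n. LINT x|lebesgue_on \<Omega>. u n x \<bullet> classical_curl \<phi> x) \<longlonglongrightarrow> (LINT x|lebesgue_on \<Omega>. h x \<bullet> \<phi> x)"
    using L2_inner_tendsto[OF u(2) v(2) L(1) lim(2)] u(3) \<phi> by (simp add: has_weak_curl_def)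
  then show "(LINT x|lebesgue_on \<Omega>. h x \<bullet> \<phi> x) = (LINT x|lebesgue_on \<Omega>. v x \<bullet> classical_curl \<phi> x)"
    using L2_inner_tendsto[OF u(1) v(1) L(2) lim(1)] LIMSEQ_unique by blast
qed

lemma curl_props:
  assumes "v \<in> H_curl \<Omega>"
  shows "curl \<Omega> v \<in> L2_fields \<Omega>" "has_weak_curl \<Omega> v (curl \<Omega> v)"
  using assms someI_ex[of "\<lambda>g. g \<in> L2_fields \<Omega> \<and> has_weak_curl \<Omega> v g"]
  by (auto simp: H_curl_def curl_def)

lemma curl_AE_eq:
  assumes \<Omega>: "open \<Omega>" "\<Omega> \<in> lmeasurable" and "v \<in> L2_fields \<Omega>" "g \<in> L2_fields \<Omega>" "has_weak_curl \<Omega> v g"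
  shows "AE x in lebesgue_on \<Omega>. curl \<Omega> v x = g x"
proof -
  have "v \<in> H_curl \<Omega>" using assms by (auto simp: H_curl_def)
  from has_weak_curl_unique[OF \<Omega> curl_props(1)[OF this] assms(4) curl_props(2)[OF this] assms(5)]
  show ?thesis .
qed

text \<open>The right-hand side is a weak curl of the combination, and weak curls are unique up to
  null sets. Equality everywhere cannot be expected, since \<open>curl\<close> is an arbitrary
  choice.\<close>

lemma curl_add_scale:
  assumes \<Omega>: "open \<Omega>" "\<Omega> \<in> lmeasurable" and uv: "u \<in> H_curl \<Omega>" "v \<in> H_curl \<Omega>"
  shows "AE x in lebesgue_on \<Omega>. curl \<Omega> (\<lambda>x. u x + t *\<^sub>R v x) x = curl \<Omega> u x + t *\<^sub>R curl \<Omega> v x"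
proof -
  have L: "u \<in> L2_fields \<Omega>" "v \<in> L2_fields \<Omega>" using uv by (auto simp: H_curl_def)
  show ?thesis
    using curl_props[OF uv(1)] curl_props[OF uv(2)] L \<Omega>
    by (intro curl_AE_eq has_weak_curl_add_scale L2_fields_add L2_fields_scale)
qed


section \<open>Convex integrands and closed subspaces of H(curl)\<close>

text \<open>For simple \<open>u\<close> the composition is patched from finitely many measurable
  slices of \<open>F\<close>. Continuity in the second argument carries this to the pointwise limit,
  and completeness of the measure absorbs the exceptional null set.\<close>

lemma measurable_Caratheodory:
  fixes F :: "'a::euclidean_space \<Rightarrow> 'b::euclidean_space \<Rightarrow> 'c::{banach, second_countable_topology}"
  assumes \<Omega>: "\<Omega> \<in> sets lebesgue"
    and F: "\<And>B. (\<lambda>x. F x B) \<in> borel_measurable (lebesgue_on \<Omega>)"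
    and cont: "AE x in lebesgue_on \<Omega>. continuous_on UNIV (F x)"
    and u: "u \<in> borel_measurable (lebesgue_on \<Omega>)"
  shows "(\<lambda>x. F x (u x)) \<in> borel_measurable (lebesgue_on \<Omega>)"
proof -
  let ?M = "lebesgue_on \<Omega>"
  obtain s where s: "\<And>n. simple_function ?M (s n)" and lim: "\<And>x. x \<in> space ?M \<Longrightarrow> (\<lambda>n. s n x) \<longlonglongrightarrow> u x"
    using borel_measurable_implies_sequence_metric[OF u, of 0] by blast
  have [measurable]: "(\<lambda>x. F x (s n x)) \<in> borel_measurable ?M" for n
  proof (rule measurable_compose_countable'[where I="s n ` space ?M" and f="\<lambda>B x. F x B"])
    show "countable (s n ` space ?M)"
      using simple_functionD(1)[OF s] by (rule countable_finite)
    show "s n \<in> ?M \<rightarrow>\<^sub>M count_space (s n ` space ?M)"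
      using simple_functionD[OF s[of n]] by (subst measurable_count_space_eq2) auto
  qed (rule F)
  have "AE x in ?M. x \<in> space ?M" by (rule AE_space)
  with cont have "AE x in ?M. lim (\<lambda>n. F x (s n x)) = F x (u x)"
  proof eventually_elim
    case (elim x)
    then have "(\<lambda>n. F x (s n x)) \<longlonglongrightarrow> F x (u x)"
      using lim by (intro continuous_on_tendsto_compose[of UNIV "F x"]) auto
    then show ?case by (rule limI)
  qed
  then show ?thesis
    by (rule borel_measurable_lebesgue_on_AE_cong[OF \<Omega>, rotated]) measurable
qed

section \<open>Quadratic bounds around the tangent plane\<close>

lemma GDERIV_line:
  assumes "\<And>B. GDERIV f B :> g B"
  shows "((\<lambda>t. f (B + t *\<^sub>R h)) has_real_derivative g (B + t *\<^sub>R h) \<bullet> h) (at t)"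
proof -
  have "((\<lambda>t. B + t *\<^sub>R h) has_derivative (\<lambda>s. s *\<^sub>R h)) (at t)"
    by (auto intro!: derivative_eq_intros)
  moreover have "(f has_derivative (\<lambda>h'. h' \<bullet> g (B + t *\<^sub>R h))) (at (B + t *\<^sub>R h))"
    using assms by (simp add: gderiv_def)
  ultimately have "((\<lambda>t. f (B + t *\<^sub>R h)) has_derivative (\<lambda>s. (s *\<^sub>R h) \<bullet> g (B + t *\<^sub>R h))) (at t)"
    by (rule has_derivative_compose)
  moreover have "(\<lambda>s. (s *\<^sub>R h) \<bullet> g (B + t *\<^sub>R h)) = (*) (g (B + t *\<^sub>R h) \<bullet> h)"
    by (simp add: fun_eq_iff inner_commute)
  ultimately show ?thesis
    by (simp add: has_field_derivative_def)
qed

text \<open>Along the segment, subtract the tangent and m/2 t^2 |h|^2; monotonicity of the gradient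
  makes the derivative of the rest nonnegative. The sign of \<open>m\<close> is free, which the
  upper bound exploits.\<close>

lemma quadratic_lower_bound:
  fixes f :: "'a::real_inner \<Rightarrow> real"
  assumes f: "\<And>B. GDERIV f B :> g B"
    and mono: "\<And>B B'. m * (norm (B - B'))\<^sup>2 \<le> (g B - g B') \<bullet> (B - B')"
  shows "m / 2 * (norm h)\<^sup>2 \<le> f (B + h) - f B - g B \<bullet> h"
proof -
  let ?\<phi> = "\<lambda>t. f (B + t *\<^sub>R h) - t * (g B \<bullet> h) - m / 2 * t\<^sup>2 * (norm h)\<^sup>2"
  have "?\<phi> 0 \<le> ?\<phi> 1"
  proof (rule DERIV_nonneg_imp_nondecreasing[of 0 1 ?\<phi>])
    fix t :: real assume t: "0 \<le> t" "t \<le> 1"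
    have "(?\<phi> has_real_derivative (g (B + t *\<^sub>R h) - g B) \<bullet> h - m * t * (norm h)\<^sup>2) (at t)"
      by (auto intro!: derivative_eq_intros GDERIV_line[OF f] simp: inner_diff_left)
    moreover have "m * t * (norm h)\<^sup>2 \<le> (g (B + t *\<^sub>R h) - g B) \<bullet> h"
    proof (cases "t = 0")
      case False
      then show ?thesis
        using mono[of "B + t *\<^sub>R h" B] t by (simp add: power_mult_distrib power2_eq_square mult.assoc mult.left_commute)
    qed simp
    ultimately show "\<exists>y. (?\<phi> has_real_derivative y) (at t) \<and> 0 \<le> y" by auto
  qed simp
  then show ?thesis by simp
qed

text \<open>This is the lower bound for \<open>- f\<close> with modulus \<open>- L\<close>, which
  the Lipschitz condition supplies through Cauchy--Schwarz.\<close>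

lemma quadratic_upper_bound:
  fixes f :: "'a::real_inner \<Rightarrow> real"
  assumes f: "\<And>B. GDERIV f B :> g B"
    and lip: "\<And>B B'. norm (g B - g B') \<le> L * norm (B - B')"
  shows "f (B + h) - f B - g B \<bullet> h \<le> L / 2 * (norm h)\<^sup>2"
proof -
  have "- L / 2 * (norm h)\<^sup>2 \<le> (- f (B + h)) - (- f B) - (- g B) \<bullet> h"
  proof (rule quadratic_lower_bound)
    show "GDERIV (\<lambda>B. - f B) B :> - g B" for B
      by (intro GDERIV_minus f)
    show "- L * (norm (B - B'))\<^sup>2 \<le> (- g B - - g B') \<bullet> (B - B')" for B B'
    proof -
      have "(g B - g B') \<bullet> (B - B') \<le> norm (g B - g B') * norm (B - B')" by (rule norm_cauchy_schwarz)
      also have "\<dots> \<le> L * norm (B - B') * norm (B - B')" using lip by (rule mult_right_mono) simp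
      finally show ?thesis by (simp add: power2_eq_square inner_diff_left)
    qed
  qed
  then show ?thesis by simp
qed

text \<open>The data without the density: the energy and the quadratic functional of the direction
  equation live on the same space \<open>V\<close> with the same source \<open>js\<close>.\<close>

locale curl_space =
  fixes \<Omega> :: "(real^3) set" and V :: "(real^3 \<Rightarrow> real^3) set" and js :: "real^3 \<Rightarrow> real^3" and c5 :: real
  assumes open_\<Omega>: "open \<Omega>" and lmeasurable_\<Omega>: "\<Omega> \<in> lmeasurable"
    and js: "js \<in> L2_fields \<Omega>"
    and closed_V: "closed_subspace_H_curl \<Omega> V"
    and Poincare: "\<And>v. v \<in> V \<Longrightarrow> L2_norm \<Omega> v \<le> c5 * L2_norm \<Omega> (curl \<Omega> v)"
begin

lemma sets_\<Omega>: "\<Omega> \<in> sets lebesgue"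
  using lmeasurable_\<Omega> by auto

abbreviation curl_norm :: "(real^3 \<Rightarrow> real^3) \<Rightarrow> real" where
  "curl_norm v \<equiv> L2_norm \<Omega> (curl \<Omega> v)"

text \<open>The sign of \<open>c5\<close> is open, and the absolute value supplies a nonnegative
  factor for later estimates.\<close>

lemma Poincare_abs: "v \<in> V \<Longrightarrow> L2_norm \<Omega> v \<le> \<bar>c5\<bar> * curl_norm v"
  using Poincare[of v] mult_right_mono[OF abs_ge_self[of c5] L2_norm_nonneg[of \<Omega> "curl \<Omega> v"]] by linarith

lemmas V_props = closed_V[unfolded closed_subspace_H_curl_def]
lemmas V_subset = V_props[THEN conjunct1]
  and V_zero = V_props[THEN conjunct2, THEN conjunct1]
  and V_add = V_props[THEN conjunct2, THEN conjunct2, THEN conjunct1, rule_format]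
  and V_scale = V_props[THEN conjunct2, THEN conjunct2, THEN conjunct2, THEN conjunct1, rule_format]
  and V_limit = V_props[THEN conjunct2, THEN conjunct2, THEN conjunct2, THEN conjunct2, rule_format]

lemma V_H_curl: "v \<in> V \<Longrightarrow> v \<in> H_curl \<Omega>"
  using V_subset by (rule subsetD)

lemma V_L2: "v \<in> V \<Longrightarrow> v \<in> L2_fields \<Omega>"
  using V_H_curl[of v] by (simp add: H_curl_def)

lemma curl_L2: "v \<in> V \<Longrightarrow> curl \<Omega> v \<in> L2_fields \<Omega>"
  by (rule curl_props(1)[OF V_H_curl])

lemma V_add_scale: "u \<in> V \<Longrightarrow> v \<in> V \<Longrightarrow> (\<lambda>x. u x + t *\<^sub>R v x) \<in> V"
  using V_add[OF _ V_scale] .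

lemma V_diff: "u \<in> V \<Longrightarrow> v \<in> V \<Longrightarrow> (\<lambda>x. u x - v x) \<in> V"
  using V_add_scale[of u v "-1"] by simp

lemma curl_lincomb:
  "u \<in> V \<Longrightarrow> v \<in> V \<Longrightarrow> AE x in lebesgue_on \<Omega>. curl \<Omega> (\<lambda>x. u x + t *\<^sub>R v x) x = curl \<Omega> u x + t *\<^sub>R curl \<Omega> v x"
  by (intro curl_add_scale open_\<Omega> lmeasurable_\<Omega> V_H_curl)

lemma curl_diff:
  "u \<in> V \<Longrightarrow> v \<in> V \<Longrightarrow> AE x in lebesgue_on \<Omega>. curl \<Omega> (\<lambda>x. u x - v x) x = curl \<Omega> u x - curl \<Omega> v x"
  using curl_lincomb[of u v "-1"] by simp

lemma curl_scale:
  assumes "v \<in> V" shows "AE x in lebesgue_on \<Omega>. curl \<Omega> (\<lambda>x. t *\<^sub>R v x) x = t *\<^sub>R curl \<Omega> v x"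
proof -
  \<comment> \<open>Scaling by \<open>t\<close> is the combination v + (t - 1) v, so the two-term
    rule covers it.\<close>
  have "AE x in lebesgue_on \<Omega>. curl \<Omega> (\<lambda>x. v x + (t - 1) *\<^sub>R v x) x = curl \<Omega> v x + (t - 1) *\<^sub>R curl \<Omega> v x"
    by (rule curl_lincomb[OF assms assms])
  then show ?thesis by (simp add: algebra_simps)
qed

lemma curl_norm_scale:
  assumes "v \<in> V" shows "curl_norm (\<lambda>x. t *\<^sub>R v x) = \<bar>t\<bar> * curl_norm v"
  using L2_norm_AE_cong[OF sets_\<Omega> curl_L2[OF V_scale[OF assms]] curl_scale[OF assms]]
  by (simp add: L2_norm_scale)

lemma curl_norm_diff:
  assumes "u \<in> V" "v \<in> V" shows "curl_norm (\<lambda>x. u x - v x) = L2_norm \<Omega> (\<lambda>x. curl \<Omega> u x - curl \<Omega> v x)"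
  by (rule L2_norm_AE_cong[OF sets_\<Omega> curl_L2[OF V_diff[OF assms]] curl_diff[OF assms]])

text \<open>Let v and h be the L2 limits of the fields and of their curls. Then h is a weak curl of
  v, so the fields converge in the graph norm, and closedness of \<open>V\<close> in that norm gives
  membership.\<close>

lemma V_complete:
  assumes u: "\<And>n::nat. u n \<in> V"
    and cauchy: "\<And>e. 0 < e \<Longrightarrow> \<exists>N. \<forall>m\<ge>N. \<forall>n\<ge>N. curl_norm (\<lambda>x. u m x - u n x) < e"
  obtains v where "v \<in> V" "(\<lambda>n. curl_norm (\<lambda>x. u n x - v x)) \<longlonglongrightarrow> 0"
proof -
  have "\<exists>N. \<forall>m\<ge>N. \<forall>n\<ge>N. L2_norm \<Omega> (\<lambda>x. u m x - u n x) < e" if e: "0 < e" for e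
  proof -
    \<comment> \<open>Adding 1 makes the divisor positive.\<close>
    have c: "0 < \<bar>c5\<bar> + 1" by simp
    with e obtain N where N: "\<And>m n. N \<le> m \<Longrightarrow> N \<le> n \<Longrightarrow> curl_norm (\<lambda>x. u m x - u n x) < e / (\<bar>c5\<bar> + 1)"
      using cauchy[of "e / (\<bar>c5\<bar> + 1)"] by auto
    have "L2_norm \<Omega> (\<lambda>x. u m x - u n x) < e" if "N \<le> m" "N \<le> n" for m n
    proof -
      have "L2_norm \<Omega> (\<lambda>x. u m x - u n x) \<le> \<bar>c5\<bar> * curl_norm (\<lambda>x. u m x - u n x)"
        by (intro Poincare_abs V_diff u)
      also have "\<dots> \<le> (\<bar>c5\<bar> + 1) * curl_norm (\<lambda>x. u m x - u n x)"
        by (intro mult_right_mono) auto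
      also have "\<dots> < e" using N[OF that] c by (simp add: field_simps)
      finally show ?thesis .
    qed
    then show ?thesis by blast
  qed
  then obtain v where v: "v \<in> L2_fields \<Omega>" "(\<lambda>n. L2_norm \<Omega> (\<lambda>x. u n x - v x)) \<longlonglongrightarrow> 0"
    using L2_complete[OF lmeasurable_\<Omega>, of u] V_L2[OF u] by blast
  obtain h where h: "h \<in> L2_fields \<Omega>" "(\<lambda>n. L2_norm \<Omega> (\<lambda>x. curl \<Omega> (u n) x - h x)) \<longlonglongrightarrow> 0"
    using L2_complete[OF lmeasurable_\<Omega>, of "\<lambda>n. curl \<Omega> (u n)"] curl_L2[OF u] cauchy
    by (auto simp: curl_norm_diff u)
  have wc: "has_weak_curl \<Omega> v h"
    using curl_props(2)[OF V_H_curl[OF u]]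
    by (rule has_weak_curl_limit[OF lmeasurable_\<Omega> V_L2[OF u] curl_L2[OF u] _ v(1) h(1) v(2) h(2)])
  have vH: "v \<in> H_curl \<Omega>" using v h wc by (auto simp: H_curl_def)
  have "AE x in lebesgue_on \<Omega>. curl \<Omega> (\<lambda>x. u n x - v x) x = curl \<Omega> (u n) x - h x" for n
    using curl_add_scale[OF open_\<Omega> lmeasurable_\<Omega> V_H_curl[OF u[of n]] vH, of "-1"]
      curl_AE_eq[OF open_\<Omega> lmeasurable_\<Omega> v(1) h(1) wc]
    by eventually_elim simp
  then have eq: "L2_norm \<Omega> (\<lambda>x. curl \<Omega> (u n) x - h x) = curl_norm (\<lambda>x. u n x - v x)" for n
    by (intro L2_norm_AE_cong[OF sets_\<Omega> L2_fields_diff[OF curl_L2[OF u] h(1)]])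
       (simp only: eq_commute[of "curl \<Omega> (u n) _ - h _"])
  have lim: "(\<lambda>n. curl_norm (\<lambda>x. u n x - v x)) \<longlonglongrightarrow> 0"
    using h(2) unfolding eq .
  have "(\<lambda>n. H_curl_norm \<Omega> (\<lambda>x. u n x - v x)) \<longlonglongrightarrow> sqrt (0\<^sup>2 + 0\<^sup>2)"
    unfolding H_curl_norm_def by (intro tendsto_intros v(2) lim)
  then have "(\<lambda>n. H_curl_norm \<Omega> (\<lambda>x. u n x - v x)) \<longlonglongrightarrow> 0"
    by simp
  then have "v \<in> V"
    using u vH by (intro V_limit[of u v] conjI allI)
  with lim that show thesis by blast
qed

end


section \<open>Uniformly convex energies on a closed subspace\<close>

text \<open>A nonnegative parabola through the origin has slope 0 there. It serves as the
  first-order optimality condition, for functionals and for the Rayleigh quotient.\<close>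

lemma quadratic_nonneg_imp_linear_eq_0:
  fixes a b :: real
  assumes "\<And>t. 0 \<le> t * a + b * t\<^sup>2"
  shows "a = 0"
proof -
  \<comment> \<open>At this point the linear term is -(|b| + 1) t^2, which outweighs b t^2 by at
    least t^2.\<close>
  define t where "t = - a / (\<bar>b\<bar> + 1)"
  have a: "a = - (t * (\<bar>b\<bar> + 1))" by (simp add: t_def field_simps)
  have "0 \<le> t * a + b * t\<^sup>2" by (rule assms)
  also have "\<dots> = (b - \<bar>b\<bar>) * t\<^sup>2 - t\<^sup>2" unfolding a by (simp add: power2_eq_square algebra_simps)
  also have "\<dots> \<le> - t\<^sup>2" by (simp add: mult_nonpos_nonneg)
  finally have "t = 0" by simp
  then show ?thesis using a by simp
qed

text \<open>Keeping \<open>g\<close> separate from \<open>f\<close> lets the energy density and the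
  quadratic density of the direction equation share one theory. Measurability of \<open>g\<close>
  for every \<open>B\<close> is demanded here; for the energy it is derived from that of
  \<open>w\<close>.\<close>

definition convex_density ::
  "(real^3) set \<Rightarrow> real \<Rightarrow> real \<Rightarrow> (real^3 \<Rightarrow> real^3 \<Rightarrow> real) \<Rightarrow> (real^3 \<Rightarrow> real^3 \<Rightarrow> real^3) \<Rightarrow> bool" where
  "convex_density \<Omega> m L f g \<longleftrightarrow> 0 < m \<and> 0 \<le> L \<and>
     (\<forall>B. (\<lambda>x. f x B) \<in> borel_measurable (lebesgue_on \<Omega>)) \<and>
     (\<forall>B. (\<lambda>x. g x B) \<in> borel_measurable (lebesgue_on \<Omega>)) \<and>
     integrable (lebesgue_on \<Omega>) (\<lambda>x. f x 0) \<and> (\<lambda>x. g x 0) \<in> L2_fields \<Omega> \<and>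
     (AE x in lebesgue_on \<Omega>. (\<forall>B. GDERIV (f x) B :> g x B) \<and>
        (\<forall>B B'. m * (norm (B - B'))\<^sup>2 \<le> (g x B - g x B') \<bullet> (B - B') \<and>
                norm (g x B - g x B') \<le> L * norm (B - B')))"

definition functional ::
  "(real^3) set \<Rightarrow> (real^3 \<Rightarrow> real^3 \<Rightarrow> real) \<Rightarrow> (real^3 \<Rightarrow> real^3) \<Rightarrow> (real^3 \<Rightarrow> real^3) \<Rightarrow> real" where
  "functional \<Omega> f js A = (LINT x|lebesgue_on \<Omega>. f x (curl \<Omega> A x) - js x \<bullet> A x)"

definition variation ::
  "(real^3) set \<Rightarrow> (real^3 \<Rightarrow> real^3 \<Rightarrow> real^3) \<Rightarrow> (real^3 \<Rightarrow> real^3) \<Rightarrow> (real^3 \<Rightarrow> real^3) \<Rightarrow> (real^3 \<Rightarrow> real^3) \<Rightarrow> real" where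
  "variation \<Omega> g js A v = (LINT x|lebesgue_on \<Omega>. g x (curl \<Omega> A x) \<bullet> curl \<Omega> v x - js x \<bullet> v x)"

locale convex_functional = curl_space +
  fixes f :: "real^3 \<Rightarrow> real^3 \<Rightarrow> real" and g :: "real^3 \<Rightarrow> real^3 \<Rightarrow> real^3" and m L :: real
  assumes density: "convex_density \<Omega> m L f g"
begin

lemma m_pos: "0 < m" and L_nonneg: "0 \<le> L"
  and f0: "integrable (lebesgue_on \<Omega>) (\<lambda>x. f x 0)" and g0: "(\<lambda>x. g x 0) \<in> L2_fields \<Omega>"
  and f_measurable: "\<And>B. (\<lambda>x. f x B) \<in> borel_measurable (lebesgue_on \<Omega>)"
  and g_measurable: "\<And>B. (\<lambda>x. g x B) \<in> borel_measurable (lebesgue_on \<Omega>)"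
  using density by (simp_all add: convex_density_def)

lemma density_AE:
  "AE x in lebesgue_on \<Omega>. (\<forall>B. GDERIV (f x) B :> g x B) \<and>
     (\<forall>B B'. m * (norm (B - B'))\<^sup>2 \<le> (g x B - g x B') \<bullet> (B - B') \<and> norm (g x B - g x B') \<le> L * norm (B - B'))"
  using density by (simp add: convex_density_def)

lemma density_bounds:
  "AE x in lebesgue_on \<Omega>. \<forall>B h. m / 2 * (norm h)\<^sup>2 \<le> f x (B + h) - f x B - g x B \<bullet> h \<and>
     f x (B + h) - f x B - g x B \<bullet> h \<le> L / 2 * (norm h)\<^sup>2"
  using density_AE
proof eventually_elim
  case (elim x)
  then show ?case
    using quadratic_lower_bound[of "f x" "g x" m] quadratic_upper_bound[of "f x" "g x" L] by blast
qed

text \<open>The Lipschitz condition gives linear growth |g(u)| <= |g(0)| + L |u|, and also the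
  continuity that makes the composition measurable.\<close>

lemma g_comp_L2:
  assumes u: "u \<in> L2_fields \<Omega>" shows "(\<lambda>x. g x (u x)) \<in> L2_fields \<Omega>"
proof (rule L2_fieldsI_bound)
  have "AE x in lebesgue_on \<Omega>. continuous_on UNIV (g x)"
    using density_AE
  proof eventually_elim
    case (elim x)
    then have "L-lipschitz_on UNIV (g x)"
      using L_nonneg by (intro lipschitz_onI) (auto simp: dist_norm)
    then show ?case by (rule lipschitz_on_continuous_on)
  qed
  then show "(\<lambda>x. g x (u x)) \<in> borel_measurable (lebesgue_on \<Omega>)"
    by (rule measurable_Caratheodory[OF sets_\<Omega> g_measurable _ L2_fieldsD(1)[OF u]])
  show "integrable (lebesgue_on \<Omega>) (\<lambda>x. 2 * (norm (g x 0))\<^sup>2 + 2 * L\<^sup>2 * (norm (u x))\<^sup>2)"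
    using L2_fieldsD(2)[OF u] L2_fieldsD(2)[OF g0] by auto
  show "AE x in lebesgue_on \<Omega>. (norm (g x (u x)))\<^sup>2 \<le> 2 * (norm (g x 0))\<^sup>2 + 2 * L\<^sup>2 * (norm (u x))\<^sup>2"
    using density_AE
  proof eventually_elim
    case (elim x)
    have "norm (g x (u x) - g x 0) \<le> L * norm (u x - 0)"
      using elim by blast
    then have "(norm (g x (u x) - g x 0))\<^sup>2 \<le> (L * norm (u x))\<^sup>2"
      by (intro power_mono) auto
    then show ?case
      using norm_add_square_le[of "g x 0" "g x (u x) - g x 0"] by (simp add: power_mult_distrib)
  qed
qed

text \<open>The two-sided tangent bound at \<open>B = 0\<close> gives at most quadratic growth in
  \<open>u\<close>.\<close>

lemma f_comp_integrable:
  assumes u: "u \<in> L2_fields \<Omega>" shows "integrable (lebesgue_on \<Omega>) (\<lambda>x. f x (u x))"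
proof (rule Bochner_Integration.integrable_bound)
  show "integrable (lebesgue_on \<Omega>) (\<lambda>x. \<bar>f x 0\<bar> + \<bar>g x 0 \<bullet> u x\<bar> + L / 2 * (norm (u x))\<^sup>2)"
    using f0 L2_inner_integrable[OF g0 u] L2_fieldsD(2)[OF u] by auto
  have "AE x in lebesgue_on \<Omega>. continuous_on UNIV (f x)"
    using density_AE
  proof eventually_elim
    case (elim x)
    then have "isCont (f x) B" for B
      unfolding gderiv_def using has_derivative_continuous by blast
    then show ?case by (simp add: continuous_at_imp_continuous_on)
  qed
  then show "(\<lambda>x. f x (u x)) \<in> borel_measurable (lebesgue_on \<Omega>)"
    by (rule measurable_Caratheodory[OF sets_\<Omega> f_measurable _ L2_fieldsD(1)[OF u]])
  show "AE x in lebesgue_on \<Omega>. norm (f x (u x)) \<le> norm (\<bar>f x 0\<bar> + \<bar>g x 0 \<bullet> u x\<bar> + L / 2 * (norm (u x))\<^sup>2)"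
    using density_bounds
  proof eventually_elim
    case (elim x)
    have "m / 2 * (norm (u x))\<^sup>2 \<le> f x (0 + u x) - f x 0 - g x 0 \<bullet> u x"
      "f x (0 + u x) - f x 0 - g x 0 \<bullet> u x \<le> L / 2 * (norm (u x))\<^sup>2"
      using elim by blast+
    moreover have "0 \<le> m / 2 * (norm (u x))\<^sup>2" using m_pos by simp
    ultimately show ?case by simp
  qed
qed

lemma variation_integrable:
  assumes "A \<in> V" "v \<in> V"
  shows "integrable (lebesgue_on \<Omega>) (\<lambda>x. g x (curl \<Omega> A x) \<bullet> curl \<Omega> v x)"
    "integrable (lebesgue_on \<Omega>) (\<lambda>x. js x \<bullet> v x)"
  by (intro L2_inner_integrable g_comp_L2 curl_L2 V_L2 js assms)+

lemma functional_integrable: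
  assumes "A \<in> V"
  shows "integrable (lebesgue_on \<Omega>) (\<lambda>x. f x (curl \<Omega> A x))" "integrable (lebesgue_on \<Omega>) (\<lambda>x. js x \<bullet> A x)"
  using f_comp_integrable[OF curl_L2[OF assms]] variation_integrable(2)[OF assms assms] .

lemma variation_lincomb:
  assumes "A \<in> V" "u \<in> V" "v \<in> V"
  shows "variation \<Omega> g js A (\<lambda>x. u x + t *\<^sub>R v x) = variation \<Omega> g js A u + t * variation \<Omega> g js A v"
proof -
  let ?G = "\<lambda>x. g x (curl \<Omega> A x)"
  have "variation \<Omega> g js A (\<lambda>x. u x + t *\<^sub>R v x)
      = (LINT x|lebesgue_on \<Omega>. (?G x \<bullet> curl \<Omega> u x - js x \<bullet> u x) + t * (?G x \<bullet> curl \<Omega> v x - js x \<bullet> v x))"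
    unfolding variation_def
  proof (rule integral_cong_AE)
    show "(\<lambda>x. ?G x \<bullet> curl \<Omega> (\<lambda>x. u x + t *\<^sub>R v x) x - js x \<bullet> (u x + t *\<^sub>R v x)) \<in> borel_measurable (lebesgue_on \<Omega>)"
      using variation_integrable[OF assms(1) V_add_scale[OF assms(2,3), of t]] by auto
    show "(\<lambda>x. (?G x \<bullet> curl \<Omega> u x - js x \<bullet> u x) + t * (?G x \<bullet> curl \<Omega> v x - js x \<bullet> v x)) \<in> borel_measurable (lebesgue_on \<Omega>)"
      using variation_integrable[OF assms(1,2)] variation_integrable[OF assms(1,3)] by auto
    show "AE x in lebesgue_on \<Omega>. ?G x \<bullet> curl \<Omega> (\<lambda>x. u x + t *\<^sub>R v x) x - js x \<bullet> (u x + t *\<^sub>R v x)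
        = (?G x \<bullet> curl \<Omega> u x - js x \<bullet> u x) + t * (?G x \<bullet> curl \<Omega> v x - js x \<bullet> v x)"
      using curl_lincomb[OF assms(2,3), of t] by eventually_elim (simp add: inner_add_right algebra_simps)
  qed
  also have "\<dots> = variation \<Omega> g js A u + t * variation \<Omega> g js A v"
    unfolding variation_def
    using variation_integrable[OF assms(1,2)] variation_integrable[OF assms(1,3)] by simp
  finally show ?thesis .
qed

lemma variation_scale:
  assumes "A \<in> V" "v \<in> V"
  shows "variation \<Omega> g js A (\<lambda>x. t *\<^sub>R v x) = t * variation \<Omega> g js A v"
  using variation_lincomb[OF assms(1,2,2), of "t - 1"] by (simp add: algebra_simps)

text \<open>Continuity of the first variation in the curl norm; the source term is controlled
  through the Poincare inequality.\<close>

lemma variation_bound: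
  assumes A: "A \<in> V"
  obtains K where "0 \<le> K" "\<And>v. v \<in> V \<Longrightarrow> \<bar>variation \<Omega> g js A v\<bar> \<le> K * curl_norm v"
proof
  let ?G = "\<lambda>x. g x (curl \<Omega> A x)"
  let ?K = "L2_norm \<Omega> ?G + L2_norm \<Omega> js * \<bar>c5\<bar>"
  show "0 \<le> ?K" by simp
  show "\<bar>variation \<Omega> g js A v\<bar> \<le> ?K * curl_norm v" if v: "v \<in> V" for v
  proof -
    have "variation \<Omega> g js A v = (LINT x|lebesgue_on \<Omega>. ?G x \<bullet> curl \<Omega> v x) - (LINT x|lebesgue_on \<Omega>. js x \<bullet> v x)"
      unfolding variation_def by (rule Bochner_Integration.integral_diff) (fact variation_integrable[OF A v])+
    moreover have "\<bar>LINT x|lebesgue_on \<Omega>. ?G x \<bullet> curl \<Omega> v x\<bar> \<le> L2_norm \<Omega> ?G * curl_norm v"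
      by (intro L2_Cauchy_Schwarz g_comp_L2 curl_L2 A v)
    moreover have "\<bar>LINT x|lebesgue_on \<Omega>. js x \<bullet> v x\<bar> \<le> L2_norm \<Omega> js * L2_norm \<Omega> v"
      by (intro L2_Cauchy_Schwarz js V_L2 v)
    moreover have "L2_norm \<Omega> js * L2_norm \<Omega> v \<le> L2_norm \<Omega> js * (\<bar>c5\<bar> * curl_norm v)"
      using Poincare_abs[OF v] by (rule mult_left_mono) simp
    ultimately show ?thesis by (simp add: algebra_simps)
  qed
qed

text \<open>The source term is linear and cancels in the remainder, so only the pointwise remainder
  of the density is left, and its bounds are integrated.\<close>

lemma functional_bounds:
  assumes A: "A \<in> V" and B: "B \<in> V"
  defines "e \<equiv> \<lambda>x. B x - A x"
  shows "m / 2 * (curl_norm e)\<^sup>2 \<le> functional \<Omega> f js B - functional \<Omega> f js A - variation \<Omega> g js A e" (is ?lower)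
    and "functional \<Omega> f js B - functional \<Omega> f js A - variation \<Omega> g js A e \<le> L / 2 * (curl_norm e)\<^sup>2" (is ?upper)
proof -
  let ?M = "lebesgue_on \<Omega>"
  let ?R = "\<lambda>x. f x (curl \<Omega> B x) - f x (curl \<Omega> A x) - g x (curl \<Omega> A x) \<bullet> curl \<Omega> e x"
  have e: "e \<in> V" unfolding e_def by (rule V_diff[OF B A])
  note int = functional_integrable[OF A] functional_integrable[OF B] variation_integrable[OF A e]
  have R: "integrable ?M ?R" using int by auto
  have n: "integrable ?M (\<lambda>x. (norm (curl \<Omega> e x))\<^sup>2)" by (rule L2_fieldsD(2)[OF curl_L2[OF e]])
  have js0: "js x \<bullet> e x = js x \<bullet> B x - js x \<bullet> A x" for x
    by (simp add: e_def inner_diff_right)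
  have eq: "functional \<Omega> f js B - functional \<Omega> f js A - variation \<Omega> g js A e = (LINT x|?M. ?R x)"
    unfolding functional_def variation_def using int unfolding js0 by simp
  have ae: "AE x in ?M. m / 2 * (norm (curl \<Omega> e x))\<^sup>2 \<le> ?R x \<and> ?R x \<le> L / 2 * (norm (curl \<Omega> e x))\<^sup>2"
    using density_bounds curl_diff[OF B A]
  proof eventually_elim
    case (elim x)
    then have "curl \<Omega> B x = curl \<Omega> A x + curl \<Omega> e x" by (simp add: e_def)
    then show ?case using elim(1) by simp
  qed
  have "(LINT x|?M. m / 2 * (norm (curl \<Omega> e x))\<^sup>2) \<le> (LINT x|?M. ?R x)"
    using n R ae by (intro integral_mono_AE) (auto elim: eventually_mono)
  then show ?lower unfolding eq L2_norm_square by simp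
  have "(LINT x|?M. ?R x) \<le> (LINT x|?M. L / 2 * (norm (curl \<Omega> e x))\<^sup>2)"
    using n R ae by (intro integral_mono_AE) (auto elim: eventually_mono)
  then show ?upper unfolding eq L2_norm_square by simp
qed

lemma functional_line_bounds:
  assumes A: "A \<in> V" and v: "v \<in> V"
  shows "m / 2 * t\<^sup>2 * (curl_norm v)\<^sup>2
      \<le> functional \<Omega> f js (\<lambda>x. A x + t *\<^sub>R v x) - functional \<Omega> f js A - t * variation \<Omega> g js A v"
    and "functional \<Omega> f js (\<lambda>x. A x + t *\<^sub>R v x) - functional \<Omega> f js A - t * variation \<Omega> g js A v
      \<le> L / 2 * t\<^sup>2 * (curl_norm v)\<^sup>2"
  using functional_bounds[OF A V_add_scale[OF A v, of t]]
  by (simp_all add: variation_scale[OF A v] curl_norm_scale[OF v] power_mult_distrib)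

section \<open>Existence, optimality and uniqueness of minimizers\<close>

lemma minimizer_exists: "\<exists>A. is_minimizer (functional \<Omega> f js) V A"
proof -
  let ?J = "functional \<Omega> f js"
  obtain K where K: "0 \<le> K" "\<And>v. v \<in> V \<Longrightarrow> \<bar>variation \<Omega> g js (\<lambda>x. 0) v\<bar> \<le> K * curl_norm v"
    using variation_bound[OF V_zero] by blast
  \<comment> \<open>Completing the square: the quadratic growth m/2 s^2 beats the linear bound K s
    on the first variation at 0.\<close>
  have low: "?J (\<lambda>x. 0) - K\<^sup>2 / (2 * m) \<le> ?J v" if v: "v \<in> V" for v
  proof -
    have "0 \<le> (m * curl_norm v - K)\<^sup>2 / (2 * m)" using m_pos by simp
    also have "\<dots> = m / 2 * (curl_norm v)\<^sup>2 - K * curl_norm v + K\<^sup>2 / (2 * m)"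
      using m_pos by (simp add: field_simps power2_eq_square)
    finally show ?thesis
      using functional_bounds(1)[OF V_zero v] K(2)[OF v] by simp
  qed
  define I where "I = Inf (?J ` V)"
  have bdd: "bdd_below (?J ` V)" using low by (auto intro!: bdd_belowI2)
  have I: "I \<le> ?J v" if "v \<in> V" for v
    unfolding I_def using that by (intro cInf_lower bdd) auto
  have "\<exists>v\<in>V. ?J v < I + 1 / real (Suc n)" for n
    using cInf_lessD[of "?J ` V" "I + 1 / real (Suc n)"] V_zero by (auto simp: I_def)
  then obtain u where u: "\<And>n. u n \<in> V" "\<And>n. ?J (u n) < I + 1 / real (Suc n)" by metis
  \<comment> \<open>Expand at the midpoint \<open>M\<close> in the directions h/2 and -h/2 and add.
    The first variations cancel, and \<open>M\<close> has energy at least \<open>I\<close>.\<close>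
  have mid: "m / 4 * (curl_norm (\<lambda>x. u j x - u k x))\<^sup>2 < 1 / real (Suc j) + 1 / real (Suc k)" for j k
  proof -
    define h where "h x = u j x - u k x" for x
    define M where "M x = u k x + (1/2) *\<^sub>R h x" for x
    have h: "h \<in> V" unfolding h_def[abs_def] by (intro V_diff u)
    have M: "M \<in> V" unfolding M_def[abs_def] by (intro V_add_scale u h)
    have "(\<lambda>x. M x + (1/2) *\<^sub>R h x) = u j" "(\<lambda>x. M x + (-1/2) *\<^sub>R h x) = u k"
      by (auto simp: M_def h_def fun_eq_iff scaleR_2[symmetric] algebra_simps simp flip: scaleR_add_left)
    then have "m / 8 * (curl_norm h)\<^sup>2 \<le> ?J (u j) - ?J M - 1/2 * variation \<Omega> g js M h"
      "m / 8 * (curl_norm h)\<^sup>2 \<le> ?J (u k) - ?J M + 1/2 * variation \<Omega> g js M h"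
      using functional_line_bounds(1)[OF M h, of "1/2"] functional_line_bounds(1)[OF M h, of "-1/2"]
      by (simp_all add: power2_eq_square)
    with I[OF M] u(2)[of j] u(2)[of k] show ?thesis unfolding h_def by simp
  qed
  have "\<exists>N. \<forall>j\<ge>N. \<forall>k\<ge>N. curl_norm (\<lambda>x. u j x - u k x) < e" if e: "0 < e" for e
  proof -
    \<comment> \<open>Each of the two errors stays below m e^2 / 8, so their sum is below m/4
      e^2.\<close>
    have "0 < m * e\<^sup>2 / 8" using e m_pos by simp
    then obtain N where N: "1 / real (Suc N) < m * e\<^sup>2 / 8"
      using nat_approx_posE by blast
    have "curl_norm (\<lambda>x. u j x - u k x) < e" if "N \<le> j" "N \<le> k" for j k
    proof -
      have "1 / real (Suc j) \<le> 1 / real (Suc N)" "1 / real (Suc k) \<le> 1 / real (Suc N)"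
        using that by (auto intro!: divide_left_mono)
      with mid[of j k] N have "m / 4 * (curl_norm (\<lambda>x. u j x - u k x))\<^sup>2 < m / 4 * e\<^sup>2" by simp
      then have "(curl_norm (\<lambda>x. u j x - u k x))\<^sup>2 < e\<^sup>2" using m_pos by simp
      then show ?thesis using e by (simp add: power2_less_imp_less)
    qed
    then show ?thesis by blast
  qed
  then obtain A where A: "A \<in> V" "(\<lambda>n. curl_norm (\<lambda>x. u n x - A x)) \<longlonglongrightarrow> 0"
    using V_complete[of u] u(1) by blast
  obtain KA where KA: "0 \<le> KA" "\<And>v. v \<in> V \<Longrightarrow> \<bar>variation \<Omega> g js A v\<bar> \<le> KA * curl_norm v"
    using variation_bound[OF A(1)] by blast
  \<comment> \<open>The tangent bound at \<open>A\<close> with the quadratic term dropped gives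
    lower semicontinuity along \<open>u\<close> with an explicit error.\<close>
  have "?J A \<le> I + 1 / real (Suc n) + KA * curl_norm (\<lambda>x. u n x - A x)" for n
  proof -
    have "0 \<le> m / 2 * (curl_norm (\<lambda>x. u n x - A x))\<^sup>2" using m_pos by simp
    then show ?thesis
      using functional_bounds(1)[OF A(1) u(1)[of n]] KA(2)[OF V_diff[OF u(1)[of n] A(1)]] u(2)[of n] by simp
  qed
  moreover have "(\<lambda>n. I + 1 / real (Suc n) + KA * curl_norm (\<lambda>x. u n x - A x)) \<longlonglongrightarrow> I + 0 + KA * 0"
    by (intro tendsto_intros A LIMSEQ_Suc[OF lim_1_over_n])
  ultimately have "?J A \<le> I"
    using LIMSEQ_le_const[of _ I "?J A"] by auto
  with I A show ?thesis unfolding is_minimizer_def by (metis order_trans)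
qed

text \<open>Along A + t v the energy difference is nonnegative and at most t F'(A) v + O(t^2), so
  the linear coefficient vanishes.\<close>

lemma minimizer_variation_eq_0:
  assumes A: "is_minimizer (functional \<Omega> f js) V A" and v: "v \<in> V"
  shows "variation \<Omega> g js A v = 0"
proof -
  have AV: "A \<in> V" using A by (simp add: is_minimizer_def)
  show ?thesis
  proof (rule quadratic_nonneg_imp_linear_eq_0)
    fix t
    have "0 \<le> functional \<Omega> f js (\<lambda>x. A x + t *\<^sub>R v x) - functional \<Omega> f js A"
      using A V_add_scale[OF AV v, of t] by (simp add: is_minimizer_def)
    with functional_line_bounds(2)[OF AV v, of t]
    show "0 \<le> t * variation \<Omega> g js A v + L / 2 * (curl_norm v)\<^sup>2 * t\<^sup>2"
      by (simp add: mult_ac)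
  qed
qed

text \<open>With vanishing first variation at \<open>A\<close>, the lower bound forces the curl of
  the difference to have norm 0, and the Poincare inequality passes this to the difference
  itself.\<close>

lemma minimizer_unique:
  assumes A: "is_minimizer (functional \<Omega> f js) V A" and B: "is_minimizer (functional \<Omega> f js) V B"
  shows "AE x in lebesgue_on \<Omega>. B x = A x"
proof -
  have V: "A \<in> V" "B \<in> V" and le: "functional \<Omega> f js B \<le> functional \<Omega> f js A"
    using A B by (auto simp: is_minimizer_def)
  have e: "(\<lambda>x. B x - A x) \<in> V" using V by (intro V_diff)
  have "m / 2 * (curl_norm (\<lambda>x. B x - A x))\<^sup>2 \<le> 0"
    using functional_bounds(1)[OF V] le minimizer_variation_eq_0[OF A e] by simp
  then have "curl_norm (\<lambda>x. B x - A x) = 0"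
    using m_pos by (simp add: mult_le_0_iff)
  then have "L2_norm \<Omega> (\<lambda>x. B x - A x) = 0"
    using Poincare_abs[OF e] L2_norm_nonneg[of \<Omega> "\<lambda>x. B x - A x"] by simp
  from L2_norm_eq_0D[OF V_L2[OF e] this] show ?thesis by simp
qed

end


section \<open>Symmetric matrices and the Armijo rule\<close>

text \<open>The eigenvector minimizes the Rayleigh quotient on the unit sphere.\<close>

lemma selfadjoint_min_eigenvector:
  fixes T :: "'a::euclidean_space \<Rightarrow> 'a"
  assumes T: "linear T" and sym: "\<And>u v. u \<bullet> T v = T u \<bullet> v"
  obtains l v where "v \<noteq> 0" "T v = l *\<^sub>R v" "\<And>u. l * (norm u)\<^sup>2 \<le> u \<bullet> T u"
proof -
  have cont: "continuous_on (sphere 0 1) (\<lambda>u. u \<bullet> T u)"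
    by (intro continuous_intros linear_continuous_on) (use T in \<open>simp add: linear_conv_bounded_linear\<close>)
  obtain b :: 'a where "b \<in> Basis" using nonempty_Basis by blast
  then have "sphere (0::'a) 1 \<noteq> {}" by (auto intro!: exI[of _ b])
  from continuous_attains_inf[OF compact_sphere this cont]
  obtain x where x: "norm x = 1" and min: "\<And>u. norm u = 1 \<Longrightarrow> x \<bullet> T x \<le> u \<bullet> T u"
    by auto
  define l where "l = x \<bullet> T x"
  have low: "l * (norm u)\<^sup>2 \<le> u \<bullet> T u" for u
  proof (cases "u = 0")
    case False
    have "l \<le> (u /\<^sub>R norm u) \<bullet> T (u /\<^sub>R norm u)"
      unfolding l_def by (rule min) (use False in simp)
    also have "\<dots> = (u \<bullet> T u) / (norm u)\<^sup>2"
      by (simp add: linear_cmul[OF T] power2_eq_square divide_simps)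
    finally show ?thesis using False by (simp add: field_simps)
  qed (simp add: linear_0[OF T])
  have "(T x - l *\<^sub>R x) \<bullet> y = 0" for y
  proof -
    \<comment> \<open>The defect u . T u - l |u|^2 is nonnegative and vanishes at x; along x + t y
      it is this quadratic in t.\<close>
    have "0 \<le> t * (2 * ((T x - l *\<^sub>R x) \<bullet> y)) + (y \<bullet> T y - l * (norm y)\<^sup>2) * t\<^sup>2" for t
    proof -
      have "(x + t *\<^sub>R y) \<bullet> T (x + t *\<^sub>R y) = l + 2 * t * (T x \<bullet> y) + t\<^sup>2 * (y \<bullet> T y)"
        using sym[of x y] by (simp add: linear_add[OF T] linear_cmul[OF T] l_def inner_add_left inner_add_right
            inner_commute[of y "T x"] power2_eq_square algebra_simps)
      moreover have "(norm (x + t *\<^sub>R y))\<^sup>2 = 1 + 2 * t * (x \<bullet> y) + t\<^sup>2 * (norm y)\<^sup>2"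
        using x by (simp only: power2_norm_eq_inner)
          (simp add: norm_eq_1 inner_add_left inner_add_right inner_commute power2_eq_square algebra_simps)
      ultimately show ?thesis
        using low[of "x + t *\<^sub>R y"] by (simp add: inner_diff_left algebra_simps)
    qed
    from quadratic_nonneg_imp_linear_eq_0[OF this] show ?thesis by simp
  qed
  then have "T x - l *\<^sub>R x = 0" by (metis inner_eq_zero_iff)
  then have "T x = l *\<^sub>R x" by simp
  moreover have "x \<noteq> 0" using x by auto
  ultimately show thesis using low by (intro that[of x l])
qed

lemma symmetric_inner_commute:
  fixes M :: "real^'n^'n"
  assumes "transpose M = M" shows "u \<bullet> (M *v v) = (M *v u) \<bullet> v"
  using dot_lmul_matrix[of u M v] transpose_matrix_vector[of M u] assms by simp

text \<open>The Rayleigh minima of M and of -M are attained at eigenvectors, so both extremes of the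
  form on the unit sphere are eigenvalues of M, up to sign in the second case.\<close>

lemma symmetric_form_bounds:
  fixes M :: "real^3^3"
  assumes sym: "transpose M = M" and ev: "\<And>l. is_eigenvalue M l \<Longrightarrow> c3 \<le> l \<and> l \<le> c4"
  shows "c3 * (norm u)\<^sup>2 \<le> (M *v u) \<bullet> u" "(M *v u) \<bullet> u \<le> c4 * (norm u)\<^sup>2"
proof -
  note comm = symmetric_inner_commute[OF sym]
  obtain l v where "v \<noteq> 0" "M *v v = l *\<^sub>R v" and l: "\<And>u. l * (norm u)\<^sup>2 \<le> u \<bullet> (M *v u)"
    by (rule selfadjoint_min_eigenvector[of "(*v) M"]) (auto simp: comm)
  then have "c3 \<le> l" using ev by (auto simp: is_eigenvalue_def)
  then have "c3 * (norm u)\<^sup>2 \<le> l * (norm u)\<^sup>2" by (rule mult_right_mono) simp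
  with l[of u] show "c3 * (norm u)\<^sup>2 \<le> (M *v u) \<bullet> u" by (simp add: inner_commute)
  have lin: "linear (\<lambda>u. - (M *v u))" by (intro linear_compose_neg matrix_vector_mul_linear)
  obtain l v where v: "v \<noteq> 0" "- (M *v v) = l *\<^sub>R v" and l: "\<And>u. l * (norm u)\<^sup>2 \<le> u \<bullet> - (M *v u)"
    by (rule selfadjoint_min_eigenvector[OF lin]) (auto simp: comm)
  from v(2) have "M *v v = (- l) *\<^sub>R v" by (metis minus_equation_iff scaleR_minus_left)
  then have "- l \<le> c4" using ev v(1) unfolding is_eigenvalue_def by blast
  then have "- l * (norm u)\<^sup>2 \<le> c4 * (norm u)\<^sup>2" by (rule mult_right_mono) simp
  with l[of u] show "(M *v u) \<bullet> u \<le> c4 * (norm u)\<^sup>2" by (simp add: inner_commute)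
qed

lemma symmetric_form_square:
  fixes M :: "real^'n^'n"
  assumes "transpose M = M"
  shows "(M *v (t *\<^sub>R d - e)) \<bullet> (t *\<^sub>R d - e)
    = t\<^sup>2 * ((M *v d) \<bullet> d) - 2 * t * ((M *v d) \<bullet> e) + (M *v e) \<bullet> e"
  using symmetric_inner_commute[OF assms, of d e]
  by (simp add: matrix_vector_mult_diff_distrib vector_scalar_commute[symmetric] matrix_vector_mult_scaleR
      inner_diff_left inner_diff_right inner_commute power2_eq_square algebra_simps)

text \<open>The form is nonnegative at t d - e. With t = c4 / m, division by 2 t turns the bound c4
  |e|^2 into m/2 |e|^2, the amount that the lower energy bound can absorb.\<close>

lemma symmetric_form_Young:
  fixes M :: "real^3^3"
  assumes sym: "transpose M = M" and ev: "\<And>l. is_eigenvalue M l \<Longrightarrow> c3 \<le> l \<and> l \<le> c4"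
    and c: "0 < c3" "c3 \<le> c4" and m: "0 < m"
  shows "(M *v d) \<bullet> e \<le> c4 / (2 * m) * ((M *v d) \<bullet> d) + m / 2 * (norm e)\<^sup>2"
proof -
  define t where "t = c4 / m"
  have t: "0 < t" using c m by (simp add: t_def)
  have "0 \<le> c3 * (norm (t *\<^sub>R d - e))\<^sup>2" using c by simp
  also have "\<dots> \<le> (M *v (t *\<^sub>R d - e)) \<bullet> (t *\<^sub>R d - e)" by (rule symmetric_form_bounds[OF sym ev])
  also have "\<dots> = t\<^sup>2 * ((M *v d) \<bullet> d) - 2 * t * ((M *v d) \<bullet> e) + (M *v e) \<bullet> e"
    by (rule symmetric_form_square[OF sym])
  also have "\<dots> \<le> t\<^sup>2 * ((M *v d) \<bullet> d) - 2 * t * ((M *v d) \<bullet> e) + c4 * (norm e)\<^sup>2"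
    using symmetric_form_bounds(2)[OF sym ev] by simp
  finally have "2 * t * ((M *v d) \<bullet> e) \<le> 2 * t * (t / 2 * ((M *v d) \<bullet> d) + m / 2 * (norm e)\<^sup>2)"
    using m by (simp add: t_def field_simps power2_eq_square)
  moreover have "0 < 2 * t" using t by simp
  ultimately have "(M *v d) \<bullet> e \<le> t / 2 * ((M *v d) \<bullet> d) + m / 2 * (norm e)\<^sup>2"
    by (rule mult_left_le_imp_le)
  then show ?thesis by (simp add: t_def mult.commute[of m 2])
qed

text \<open>Take e = M d and m = 1 in the Young estimate and absorb half of |M d|^2; this avoids
  diagonalizing M.\<close>

lemma symmetric_norm_bound:
  fixes M :: "real^3^3"
  assumes sym: "transpose M = M" and ev: "\<And>l. is_eigenvalue M l \<Longrightarrow> c3 \<le> l \<and> l \<le> c4"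
    and c: "0 < c3" "c3 \<le> c4"
  shows "norm (M *v d) \<le> c4 * norm d"
proof (rule power2_le_imp_le)
  have c4: "0 < c4" using c by simp
  have "(M *v d) \<bullet> (M *v d) \<le> c4 / (2 * 1) * ((M *v d) \<bullet> d) + 1 / 2 * (norm (M *v d))\<^sup>2"
    by (rule symmetric_form_Young[OF sym ev c zero_less_one])
  then have "(norm (M *v d))\<^sup>2 \<le> c4 * ((M *v d) \<bullet> d)"
    by (simp add: power2_norm_eq_inner)
  also have "\<dots> \<le> c4 * (c4 * (norm d)\<^sup>2)"
    using symmetric_form_bounds(2)[OF sym ev] c4 by (intro mult_left_mono) auto
  finally show "(norm (M *v d))\<^sup>2 \<le> (c4 * norm d)\<^sup>2"
    by (simp add: power2_eq_square algebra_simps)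
qed (use c in simp)

text \<open>The powers of \<rho> decrease, so the greatest accepted one belongs to the least
  accepted exponent \<open>k0\<close>. If k0 > 0, the power before it was rejected and hence exceeds
  \<tau>; the loss is one factor \<rho>.\<close>

lemma armijo_step_ge:
  assumes \<rho>: "0 < \<rho>" "\<rho> < 1" and \<tau>: "0 < \<tau>"
    and ok: "\<And>t. 0 < t \<Longrightarrow> t \<le> \<tau> \<Longrightarrow> \<Phi> t \<le> \<Phi> 0 + \<sigma> * t * deriv \<Phi> 0"
  shows "\<Phi> (armijo_step \<sigma> \<rho> \<Phi>) \<le> \<Phi> 0 + \<sigma> * armijo_step \<sigma> \<rho> \<Phi> * deriv \<Phi> 0"
    and "min 1 (\<rho> * \<tau>) \<le> armijo_step \<sigma> \<rho> \<Phi>"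
proof -
  let ?P = "\<lambda>t. \<Phi> t \<le> \<Phi> 0 + \<sigma> * t * deriv \<Phi> 0"
  obtain k where "\<rho> ^ k < \<tau>" using real_arch_pow_inv[OF \<tau> \<rho>(2)] by blast
  then have ex: "?P (\<rho> ^ k)" using ok \<rho> by simp
  define k0 where "k0 = (LEAST k. ?P (\<rho> ^ k))"
  have k0: "?P (\<rho> ^ k0)" unfolding k0_def by (rule LeastI[of _ k]) (rule ex)
  have least: "k0 \<le> j" if "?P (\<rho> ^ j)" for j unfolding k0_def by (rule Least_le) (rule that)
  have eq: "armijo_step \<sigma> \<rho> \<Phi> = \<rho> ^ k0"
    unfolding armijo_step_def
  proof (rule Greatest_equality)
    show "(\<exists>m. \<rho> ^ k0 = \<rho> ^ m) \<and> ?P (\<rho> ^ k0)" using k0 by blast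
    show "y \<le> \<rho> ^ k0" if "(\<exists>m. y = \<rho> ^ m) \<and> ?P y" for y
      using that least \<rho> by (auto intro!: power_decreasing)
  qed
  show "?P (armijo_step \<sigma> \<rho> \<Phi>)" unfolding eq by (rule k0)
  show "min 1 (\<rho> * \<tau>) \<le> armijo_step \<sigma> \<rho> \<Phi>"
  proof (cases k0)
    case 0
    then show ?thesis by (simp add: eq)
  next
    case (Suc j)
    then have "\<not> ?P (\<rho> ^ j)" using least[of j] by auto
    then have "\<tau> < \<rho> ^ j" using ok[of "\<rho> ^ j"] \<rho> by force
    then have "\<rho> * \<tau> \<le> \<rho> ^ k0" using \<rho> Suc by simp
    then show ?thesis by (simp add: eq)
  qed
qed

text \<open>The Armijo condition contains \<open>deriv \<Phi> 0\<close>, while the energy is known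
  along lines only through two-sided quadratic bounds. These suffice for differentiability at
  0.\<close>

lemma DERIV_0_if_quadratic_remainder:
  fixes \<Phi> :: "real \<Rightarrow> real"
  assumes "\<And>t. \<bar>\<Phi> t - \<Phi> 0 - t * D\<bar> \<le> C * t\<^sup>2"
  shows "(\<Phi> has_real_derivative D) (at 0)"
proof -
  have "((\<lambda>h. (\<Phi> h - \<Phi> 0) / h - D) \<longlongrightarrow> 0) (at 0)"
  proof (rule Lim_null_comparison)
    show "\<forall>\<^sub>F h in at 0. norm ((\<Phi> h - \<Phi> 0) / h - D) \<le> C * \<bar>h\<bar>"
    proof (rule eventually_at_filter[THEN iffD2], rule always_eventually, intro allI impI)
      fix h :: real assume h: "h \<noteq> 0"
      have "norm ((\<Phi> h - \<Phi> 0) / h - D) = \<bar>\<Phi> h - \<Phi> 0 - h * D\<bar> / \<bar>h\<bar>"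
        using h by (simp add: diff_divide_distrib flip: abs_divide)
      also have "\<dots> \<le> C * h\<^sup>2 / \<bar>h\<bar>" using assms by (intro divide_right_mono) auto
      also have "\<dots> = C * \<bar>h\<bar>" using h by (simp add: power2_eq_square field_simps abs_if)
      finally show "norm ((\<Phi> h - \<Phi> 0) / h - D) \<le> C * \<bar>h\<bar>" .
    qed
    show "((\<lambda>h. C * \<bar>h\<bar>) \<longlongrightarrow> 0) (at 0)"
      by (auto intro!: tendsto_eq_intros)
  qed
  then show ?thesis
    using LIM_zero_cancel by (auto simp: has_field_derivative_iff)
qed


section \<open>Search directions and energy descent\<close>

lemma admissible_AE:
  assumes "admissible_matrix_field \<Omega> c3 c4 S"
  shows "AE x in lebesgue_on \<Omega>. transpose (S x) = S x \<and> (\<forall>l. is_eigenvalue (S x) l \<longrightarrow> c3 \<le> l \<and> l \<le> c4)"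
  using assms by (auto simp: admissible_matrix_field_def symmetric_positive_definite_def elim: eventually_mono)

text \<open>The eigenvalue bounds give the monotonicity constant c3 and the Lipschitz constant c4.
  The linear part \<open>p\<close> will hold the gradient at the current iterate; with p = 0 the
  result yields the integrability of the matrix form.\<close>

lemma convex_density_quadratic:
  assumes \<Omega>: "\<Omega> \<in> lmeasurable" and S: "admissible_matrix_field \<Omega> c3 c4 S" and c: "0 < c3" "c3 \<le> c4"
    and p: "p \<in> L2_fields \<Omega>"
  shows "convex_density \<Omega> c3 c4 (\<lambda>x B. 1 / 2 * ((S x *v B) \<bullet> B) + p x \<bullet> B) (\<lambda>x B. S x *v B + p x)"
proof -
  have Sm: "S \<in> borel_measurable (lebesgue_on \<Omega>)" using S by (simp add: admissible_matrix_field_def)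
  have SB [measurable]: "(\<lambda>x. S x *v B) \<in> borel_measurable (lebesgue_on \<Omega>)" for B
  proof (rule borel_measurable_continuous_on[OF _ Sm])
    have "linear (\<lambda>M :: real^3^3. M *v B)"
      by (rule linearI) (auto simp: matrix_vector_mult_add_rdistrib scaleR_matrix_vector_assoc)
    then show "continuous_on UNIV (\<lambda>M :: real^3^3. M *v B)"
      by (simp add: linear_conv_bounded_linear linear_continuous_on)
  qed
  have pm [measurable]: "p \<in> borel_measurable (lebesgue_on \<Omega>)" by (rule L2_fieldsD(1)[OF p])
  have "AE x in lebesgue_on \<Omega>. (\<forall>B. GDERIV (\<lambda>B. 1 / 2 * ((S x *v B) \<bullet> B) + p x \<bullet> B) B :> S x *v B + p x) \<and>
        (\<forall>B B'. c3 * (norm (B - B'))\<^sup>2 \<le> ((S x *v B + p x) - (S x *v B' + p x)) \<bullet> (B - B') \<and>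
                norm ((S x *v B + p x) - (S x *v B' + p x)) \<le> c4 * norm (B - B'))"
    using admissible_AE[OF S]
  proof eventually_elim
    case (elim x)
    then have sym: "transpose (S x) = S x" and ev: "\<And>l. is_eigenvalue (S x) l \<Longrightarrow> c3 \<le> l \<and> l \<le> c4" by auto
    have diff: "(S x *v B + p x) - (S x *v B' + p x) = S x *v (B - B')" for B B'
      by (simp add: matrix_vector_mult_diff_distrib)
    have "GDERIV (\<lambda>B. 1 / 2 * ((S x *v B) \<bullet> B) + p x \<bullet> B) B :> S x *v B + p x" for B
    proof -
      have d: "((\<lambda>B. S x *v B) has_derivative (\<lambda>h. S x *v h)) (at B)"
        by (rule bounded_linear_imp_has_derivative) (rule matrix_vector_mul_bounded_linear)
      have "((\<lambda>B. 1 / 2 * ((S x *v B) \<bullet> B) + p x \<bullet> B) has_derivative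
          (\<lambda>h. 1 / 2 * ((S x *v B) \<bullet> h + (S x *v h) \<bullet> B) + p x \<bullet> h)) (at B)"
        by (intro has_derivative_add has_derivative_mult_right has_derivative_inner d has_derivative_ident
            has_derivative_inner_right)
      moreover have "(\<lambda>h. 1 / 2 * ((S x *v B) \<bullet> h + (S x *v h) \<bullet> B) + p x \<bullet> h) = (\<lambda>h. h \<bullet> (S x *v B + p x))"
        using symmetric_inner_commute[OF sym] by (simp add: fun_eq_iff inner_commute inner_add_right)
      ultimately show ?thesis by (simp add: gderiv_def)
    qed
    then show ?case
      unfolding diff using symmetric_form_bounds(1)[OF sym ev] symmetric_norm_bound[OF sym ev c] by simp
  qed
  with c p show ?thesis by (simp add: convex_density_def)
qed

text \<open>\<open>gradient\<close> is a definite description, so its value is known only once the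
  vector representing the derivative is shown to be unique.\<close>

lemma GDERIV_gradient:
  assumes "C1_function f" shows "GDERIV f B :> gradient f B"
proof -
  obtain D where D: "GDERIV f B :> D" using assms by (auto simp: C1_function_def)
  have "D' = D" if "GDERIV f B :> D'" for D'
  proof -
    have "(\<lambda>h. h \<bullet> D') = (\<lambda>h. h \<bullet> D)"
      using that D unfolding gderiv_def by (rule has_derivative_unique)
    then have "(D' - D) \<bullet> D' = (D' - D) \<bullet> D" by (rule fun_cong)
    then have "(D' - D) \<bullet> (D' - D) = 0" by (simp add: inner_diff_right)
    then show ?thesis by simp
  qed
  with D have "gradient f B = D" unfolding gradient_def by (rule the_equality)
  with D show ?thesis by simp
qed

lemma convex_density_energy:
  assumes \<Omega>: "\<Omega> \<in> lmeasurable" and w: "energy_density \<Omega> w Jp c1 c2" and c: "0 < c1" "c1 \<le> c2"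
  shows "convex_density \<Omega> (1 / c2) (1 / c1) (\<lambda>x B. w x B (Jp x)) (grad_B w Jp)"
proof -
  let ?M = "lebesgue_on \<Omega>"
  have fm: "(\<lambda>x. w x B (Jp x)) \<in> borel_measurable ?M" for B
    using w by (simp add: energy_density_def)
  have ae: "AE x in ?M. (\<forall>B. GDERIV (\<lambda>B. w x B (Jp x)) B :> grad_B w Jp x B) \<and>
      (\<forall>B B'. 1 / c2 * (norm (B - B'))\<^sup>2 \<le> (grad_B w Jp x B - grad_B w Jp x B') \<bullet> (B - B') \<and>
              norm (grad_B w Jp x B - grad_B w Jp x B') \<le> 1 / c1 * norm (B - B'))"
    using w unfolding energy_density_def grad_B_def
    by (elim conjE eventually_mono) (simp add: GDERIV_gradient)
  \<comment> \<open>Each directional derivative is almost everywhere the limit of difference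
    quotients with increments 1/(n+1), and these are measurable in x because \<open>w\<close>
    is.\<close>
  have "(\<lambda>x. grad_B w Jp x B \<bullet> b) \<in> borel_measurable ?M" for B b
  proof (rule borel_measurable_lebesgue_on_AE_cong)
    show "\<Omega> \<in> sets lebesgue" using \<Omega> by auto
    let ?q = "\<lambda>n x. (w x (B + (1 / real (Suc n)) *\<^sub>R b) (Jp x) - w x B (Jp x)) / (1 / real (Suc n))"
    show "(\<lambda>x. lim (\<lambda>n. ?q n x)) \<in> borel_measurable ?M"
      using fm by (intro borel_measurable_lim_metric borel_measurable_divide borel_measurable_diff) auto
    show "AE x in ?M. lim (\<lambda>n. ?q n x) = grad_B w Jp x B \<bullet> b"
      using ae
    proof eventually_elim
      case (elim x)
      have "((\<lambda>t. w x (B + t *\<^sub>R b) (Jp x)) has_real_derivative grad_B w Jp x (B + 0 *\<^sub>R b) \<bullet> b) (at 0)"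
        using elim by (intro GDERIV_line[where f="\<lambda>B. w x B (Jp x)"]) blast
      then have "((\<lambda>h. (w x (B + h *\<^sub>R b) (Jp x) - w x B (Jp x)) / h) \<longlongrightarrow> grad_B w Jp x B \<bullet> b) (at 0)"
        by (simp add: has_field_derivative_iff)
      moreover have "filterlim (\<lambda>n. 1 / real (Suc n)) (at 0) sequentially"
        by (intro filterlim_atI LIMSEQ_Suc[OF lim_1_over_n]) simp
      ultimately have "(\<lambda>n. ?q n x) \<longlonglongrightarrow> grad_B w Jp x B \<bullet> b"
        by (rule filterlim_compose)
      then show ?case by (rule limI)
    qed
  qed
  then have "(\<lambda>x. grad_B w Jp x B) \<in> borel_measurable ?M" for B
    by (subst borel_measurable_euclidean_space) blast
  moreover have "integrable ?M (\<lambda>x. w x 0 (Jp x))" "(\<lambda>x. grad_B w Jp x 0) \<in> L2_fields \<Omega>"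
    using w by (simp_all add: energy_density_def)
  ultimately show ?thesis
    using c fm ae by (simp add: convex_density_def)
qed

lemma functional_energy: "functional \<Omega> (\<lambda>x B. w x B (Jp x)) js = energy \<Omega> w Jp js"
  by (simp add: fun_eq_iff functional_def energy_def)

lemma (in curl_space) matrix_form_integrable:
  assumes S: "admissible_matrix_field \<Omega> c3 c4 S" and c: "0 < c3" "c3 \<le> c4" and "u \<in> V" "v \<in> V"
  shows "integrable (lebesgue_on \<Omega>) (\<lambda>x. (S x *v curl \<Omega> u x) \<bullet> curl \<Omega> v x)"
proof -
  \<comment> \<open>The map B -> S x B is the gradient of the quadratic density with zero linear
    part, so its composition with a curl is in L2.\<close>
  interpret Q: convex_functional \<Omega> V js c5 "\<lambda>x B. 1 / 2 * ((S x *v B) \<bullet> B) + 0 \<bullet> B" "\<lambda>x B. S x *v B + 0" c3 c4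
    by unfold_locales (rule convex_density_quadratic[OF lmeasurable_\<Omega> S c L2_fields_zero])
  show ?thesis using Q.variation_integrable(1)[OF assms(4,5)] by simp
qed

context convex_functional
begin

text \<open>The direction equation is solved by minimizing the quadratic functional whose density is
  \<open>1/2 (S x *v B) \<bullet> B + g x (curl A x) \<bullet> B\<close>.\<close>

lemma search_direction_exists:
  assumes S: "admissible_matrix_field \<Omega> c3 c4 S" and c: "0 < c3" "c3 \<le> c4" and A: "A \<in> V"
  shows "\<exists>d\<in>V. \<forall>v\<in>V. (LINT x|lebesgue_on \<Omega>. (S x *v curl \<Omega> d x) \<bullet> curl \<Omega> v x) = - variation \<Omega> g js A v"
proof -
  define p where "p x = g x (curl \<Omega> A x)" for x
  have p: "p \<in> L2_fields \<Omega>" unfolding p_def[abs_def] by (rule g_comp_L2[OF curl_L2[OF A]])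
  interpret Q: convex_functional \<Omega> V js c5 "\<lambda>x B. 1 / 2 * ((S x *v B) \<bullet> B) + p x \<bullet> B" "\<lambda>x B. S x *v B + p x" c3 c4
    by unfold_locales (rule convex_density_quadratic[OF lmeasurable_\<Omega> S c p])
  obtain d where d: "is_minimizer (functional \<Omega> (\<lambda>x B. 1 / 2 * ((S x *v B) \<bullet> B) + p x \<bullet> B) js) V d"
    using Q.minimizer_exists by blast
  have dV: "d \<in> V" using d by (simp add: is_minimizer_def)
  have "(LINT x|lebesgue_on \<Omega>. (S x *v curl \<Omega> d x) \<bullet> curl \<Omega> v x) = - variation \<Omega> g js A v" if v: "v \<in> V" for v
  proof -
    note int = matrix_form_integrable[OF S c dV v] variation_integrable[OF A v]
    have "0 = (LINT x|lebesgue_on \<Omega>. (S x *v curl \<Omega> d x) \<bullet> curl \<Omega> v x + (g x (curl \<Omega> A x) \<bullet> curl \<Omega> v x - js x \<bullet> v x))"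
      using Q.minimizer_variation_eq_0[OF d v]
      by (simp add: variation_def p_def inner_add_left add_diff_eq)
    also have "\<dots> = (LINT x|lebesgue_on \<Omega>. (S x *v curl \<Omega> d x) \<bullet> curl \<Omega> v x) + variation \<Omega> g js A v"
      unfolding variation_def using int
      by (intro Bochner_Integration.integral_add Bochner_Integration.integrable_diff)
    finally show ?thesis by simp
  qed
  with dV show ?thesis by blast
qed

lemma descent_step:
  fixes \<sigma> \<rho> :: real
  assumes S: "admissible_matrix_field \<Omega> c3 c4 S" and c: "0 < c3" "c3 \<le> c4" and L: "0 < L"
    and \<sigma>: "0 < \<sigma>" "\<sigma> < 1" and \<rho>: "0 < \<rho>" "\<rho> < 1"
    and A: "A \<in> V" and d: "d \<in> V" and min: "is_minimizer (functional \<Omega> f js) V A'"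
    and dir: "\<And>v. v \<in> V \<Longrightarrow> (LINT x|lebesgue_on \<Omega>. (S x *v curl \<Omega> d x) \<bullet> curl \<Omega> v x) = - variation \<Omega> g js A v"
  defines "\<Phi> \<equiv> \<lambda>t. functional \<Omega> f js (\<lambda>x. A x + t *\<^sub>R d x)"
  shows "\<Phi> (armijo_step \<sigma> \<rho> \<Phi>) - functional \<Omega> f js A'
    \<le> (1 - 2 * m / c4 * (\<sigma> * min 1 (\<rho> * (2 * (1 - \<sigma>) * c3 / L)))) * (functional \<Omega> f js A - functional \<Omega> f js A')"
proof -
  let ?M = "lebesgue_on \<Omega>"
  define Q where "Q = (LINT x|?M. (S x *v curl \<Omega> d x) \<bullet> curl \<Omega> d x)"
  \<comment> \<open>Solves L t / (2 c3) = 1 - \<sigma>: up to this length the quadratic remainder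
    uses at most the share 1 - \<sigma> of the linear decrease t Q.\<close>
  define \<tau> where "\<tau> = 2 * (1 - \<sigma>) * c3 / L"
  have Qv: "variation \<Omega> g js A d = - Q" using dir[OF d] by (simp add: Q_def)
  have Qint: "integrable ?M (\<lambda>x. (S x *v curl \<Omega> d x) \<bullet> curl \<Omega> d x)"
    by (rule matrix_form_integrable[OF S c d d])
  have "(LINT x|?M. c3 * (norm (curl \<Omega> d x))\<^sup>2) \<le> Q"
    unfolding Q_def
  proof (rule integral_mono_AE[OF _ Qint])
    show "integrable ?M (\<lambda>x. c3 * (norm (curl \<Omega> d x))\<^sup>2)"
      using L2_fieldsD(2)[OF curl_L2[OF d]] by simp
    show "AE x in ?M. c3 * (norm (curl \<Omega> d x))\<^sup>2 \<le> (S x *v curl \<Omega> d x) \<bullet> curl \<Omega> d x"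
      using admissible_AE[OF S] by eventually_elim (intro symmetric_form_bounds(1), auto)
  qed
  then have NQ: "c3 * (curl_norm d)\<^sup>2 \<le> Q" by (simp add: L2_norm_square)
  then have Q0: "0 \<le> Q" using c by (meson mult_nonneg_nonneg less_imp_le order_trans zero_le_power2)
  have \<Phi>0: "\<Phi> 0 = functional \<Omega> f js A" by (simp add: \<Phi>_def)
  have up: "\<Phi> t - \<Phi> 0 + t * Q \<le> L / 2 * t\<^sup>2 * (curl_norm d)\<^sup>2" for t
    using functional_line_bounds(2)[OF A d, of t] by (simp add: \<Phi>_def Qv)
  have lo: "0 \<le> \<Phi> t - \<Phi> 0 + t * Q" for t
  proof -
    have "0 \<le> m / 2 * t\<^sup>2 * (curl_norm d)\<^sup>2" using m_pos by simp
    then show ?thesis using functional_line_bounds(1)[OF A d, of t] by (simp add: \<Phi>_def Qv)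
  qed
  have "(\<Phi> has_real_derivative - Q) (at 0)"
    using up lo by (intro DERIV_0_if_quadratic_remainder[where C="L / 2 * (curl_norm d)\<^sup>2"]) (simp add: mult_ac)
  then have der: "deriv \<Phi> 0 = - Q" by (rule DERIV_imp_deriv)
  have \<tau>: "0 < \<tau>" using \<sigma> c L by (simp add: \<tau>_def)
  have ok: "\<Phi> t \<le> \<Phi> 0 + \<sigma> * t * deriv \<Phi> 0" if t: "0 < t" "t \<le> \<tau>" for t
  proof -
    have "(curl_norm d)\<^sup>2 \<le> Q / c3" using NQ c by (simp add: field_simps)
    then have "L / 2 * t\<^sup>2 * (curl_norm d)\<^sup>2 \<le> L / 2 * t\<^sup>2 * (Q / c3)"
      using L by (intro mult_left_mono) auto
    also have "\<dots> = (L * t / (2 * c3)) * (t * Q)" using c by (simp add: power2_eq_square)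
    also have "\<dots> \<le> (1 - \<sigma>) * (t * Q)"
      using t Q0 c L by (intro mult_right_mono) (auto simp: \<tau>_def field_simps)
    finally show ?thesis using up[of t] by (simp add: der algebra_simps)
  qed
  define \<alpha> where "\<alpha> = armijo_step \<sigma> \<rho> \<Phi>"
  note arm = armijo_step_ge[OF \<rho> \<tau>, of \<Phi> \<sigma>, OF ok, folded \<alpha>_def]
  have "\<Phi> \<alpha> \<le> \<Phi> 0 - \<sigma> * \<alpha> * Q" using arm(1) by (simp add: der)
  moreover have "\<sigma> * min 1 (\<rho> * \<tau>) * Q \<le> \<sigma> * \<alpha> * Q"
    using arm(2) \<sigma> Q0 by (intro mult_right_mono mult_left_mono) auto
  ultimately have dec: "\<Phi> \<alpha> \<le> \<Phi> 0 - \<sigma> * min 1 (\<rho> * \<tau>) * Q" by linarith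
  have A': "A' \<in> V" using min by (simp add: is_minimizer_def)
  let ?e = "\<lambda>x. A' x - A x"
  have e: "?e \<in> V" by (rule V_diff[OF A' A])
  have "(LINT x|?M. (S x *v curl \<Omega> d x) \<bullet> curl \<Omega> ?e x)
      \<le> (LINT x|?M. c4 / (2 * m) * ((S x *v curl \<Omega> d x) \<bullet> curl \<Omega> d x) + m / 2 * (norm (curl \<Omega> ?e x))\<^sup>2)"
  proof (rule integral_mono_AE)
    show "integrable ?M (\<lambda>x. (S x *v curl \<Omega> d x) \<bullet> curl \<Omega> ?e x)"
      by (rule matrix_form_integrable[OF S c d e])
    show "integrable ?M (\<lambda>x. c4 / (2 * m) * ((S x *v curl \<Omega> d x) \<bullet> curl \<Omega> d x) + m / 2 * (norm (curl \<Omega> ?e x))\<^sup>2)"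
      using L2_fieldsD(2)[OF curl_L2[OF e]] Qint by simp
    show "AE x in ?M. (S x *v curl \<Omega> d x) \<bullet> curl \<Omega> ?e x
        \<le> c4 / (2 * m) * ((S x *v curl \<Omega> d x) \<bullet> curl \<Omega> d x) + m / 2 * (norm (curl \<Omega> ?e x))\<^sup>2"
      using admissible_AE[OF S]
    proof eventually_elim
      case (elim x)
      then show ?case by (intro symmetric_form_Young[OF _ _ c m_pos]) auto
    qed
  qed
  also have "\<dots> = c4 / (2 * m) * Q + m / 2 * (curl_norm ?e)\<^sup>2"
    unfolding Q_def L2_norm_square using L2_fieldsD(2)[OF curl_L2[OF e]] Qint by simp
  \<comment> \<open>With e = A' - A the lower bound says that the gap is at most - F'(A) e - m/2
    |e|^2. The direction equation turns - F'(A) e into the matrix form, and the Young term m/2 |e|^2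
    cancels.\<close>
  finally have "functional \<Omega> f js A - functional \<Omega> f js A' \<le> c4 / (2 * m) * Q"
    using functional_bounds(1)[OF A A'] dir[OF e] by simp
  then have "2 * m / c4 * (functional \<Omega> f js A - functional \<Omega> f js A') \<le> Q"
    using m_pos c by (simp add: field_simps)
  then have "\<sigma> * min 1 (\<rho> * \<tau>) * (2 * m / c4 * (functional \<Omega> f js A - functional \<Omega> f js A')) \<le> \<sigma> * min 1 (\<rho> * \<tau>) * Q"
    using \<sigma> \<rho> \<tau> by (intro mult_left_mono) auto
  with dec \<Phi>0 have "\<Phi> \<alpha> - functional \<Omega> f js A' \<le> (functional \<Omega> f js A - functional \<Omega> f js A')
      - \<sigma> * min 1 (\<rho> * \<tau>) * (2 * m / c4 * (functional \<Omega> f js A - functional \<Omega> f js A'))"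
    by linarith
  moreover have "E - s * (r * E) = (1 - r * s) * E" for E s r :: real
    by (simp add: algebra_simps)
  ultimately show ?thesis
    unfolding \<alpha>_def \<tau>_def by (simp only:)
qed

section \<open>From energy decay to linear convergence\<close>

lemma energy_gap_bounds:
  assumes min: "is_minimizer (functional \<Omega> f js) V A'" and A: "A \<in> V"
  shows "m / 2 * (curl_norm (\<lambda>x. A x - A' x))\<^sup>2 \<le> functional \<Omega> f js A - functional \<Omega> f js A'"
    and "functional \<Omega> f js A - functional \<Omega> f js A' \<le> L / 2 * (curl_norm (\<lambda>x. A x - A' x))\<^sup>2"
proof -
  have A': "A' \<in> V" using min by (simp add: is_minimizer_def)
  show "m / 2 * (curl_norm (\<lambda>x. A x - A' x))\<^sup>2 \<le> functional \<Omega> f js A - functional \<Omega> f js A'"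
    "functional \<Omega> f js A - functional \<Omega> f js A' \<le> L / 2 * (curl_norm (\<lambda>x. A x - A' x))\<^sup>2"
    using functional_bounds[OF A' A] minimizer_variation_eq_0[OF min V_diff[OF A A']] by simp_all
qed

text \<open>The gap contracts by q^2 and is comparable to the squared distance, so the distance
  decays like q^n. The ratio of the two comparison constants enters once, as
  \<open>sqrt (L / m)\<close>, independently of n.\<close>

lemma linear_convergence:
  assumes min: "is_minimizer (functional \<Omega> f js) V A'" and An: "\<And>n::nat. An n \<in> V" and L: "0 < L" and q: "0 \<le> q"
    and step: "\<And>n. functional \<Omega> f js (An (Suc n)) - functional \<Omega> f js A' \<le> q\<^sup>2 * (functional \<Omega> f js (An n) - functional \<Omega> f js A')"
  shows "curl_norm (\<lambda>x. An n x - A' x) \<le> sqrt (L / m) * q ^ n * curl_norm (\<lambda>x. An 0 x - A' x)"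
proof (rule power2_le_imp_le)
  let ?E = "\<lambda>n. functional \<Omega> f js (An n) - functional \<Omega> f js A'"
  have E: "?E n \<le> (q\<^sup>2) ^ n * ?E 0"
  proof (induction n)
    case (Suc n)
    have "?E (Suc n) \<le> q\<^sup>2 * ?E n" by (rule step)
    also have "\<dots> \<le> q\<^sup>2 * ((q\<^sup>2) ^ n * ?E 0)" using Suc by (rule mult_left_mono) simp
    finally show ?case by simp
  qed simp
  have "m / 2 * (curl_norm (\<lambda>x. An n x - A' x))\<^sup>2 \<le> ?E n" by (rule energy_gap_bounds(1)[OF min An])
  also have "\<dots> \<le> (q\<^sup>2) ^ n * ?E 0" by (rule E)
  also have "\<dots> \<le> (q\<^sup>2) ^ n * (L / 2 * (curl_norm (\<lambda>x. An 0 x - A' x))\<^sup>2)"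
    by (intro mult_left_mono energy_gap_bounds(2)[OF min An]) simp
  finally have "(curl_norm (\<lambda>x. An n x - A' x))\<^sup>2 \<le> L / m * (q\<^sup>2) ^ n * (curl_norm (\<lambda>x. An 0 x - A' x))\<^sup>2"
    using m_pos by (simp add: field_simps)
  also have "\<dots> = (sqrt (L / m) * q ^ n * curl_norm (\<lambda>x. An 0 x - A' x))\<^sup>2"
    using m_pos L by (simp add: power_mult_distrib power_mult[symmetric] mult.commute)
  finally show "(curl_norm (\<lambda>x. An n x - A' x))\<^sup>2 \<le> (sqrt (L / m) * q ^ n * curl_norm (\<lambda>x. An 0 x - A' x))\<^sup>2" .
qed (use q m_pos L in simp)

end

lemma (in curl_space) H_curl_norm_tendsto_0:
  assumes u: "\<And>n::nat. u n \<in> V" and lim: "(\<lambda>n. curl_norm (u n)) \<longlonglongrightarrow> 0"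
  shows "(\<lambda>n. H_curl_norm \<Omega> (u n)) \<longlonglongrightarrow> 0"
proof -
  have "(\<lambda>n. L2_norm \<Omega> (u n)) \<longlonglongrightarrow> 0"
  proof (rule Lim_null_comparison)
    show "\<forall>\<^sub>F n in sequentially. norm (L2_norm \<Omega> (u n)) \<le> \<bar>c5\<bar> * curl_norm (u n)"
      using Poincare_abs[OF u] by simp
    show "(\<lambda>n. \<bar>c5\<bar> * curl_norm (u n)) \<longlonglongrightarrow> 0" by (rule tendsto_mult_right_zero[OF lim])
  qed
  then have "(\<lambda>n. H_curl_norm \<Omega> (u n)) \<longlonglongrightarrow> sqrt (0\<^sup>2 + 0\<^sup>2)"
    unfolding H_curl_norm_def by (intro tendsto_intros lim)
  then show ?thesis by simp
qed


lemma (in curl_space) is_search_direction_iff: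
  assumes "convex_functional \<Omega> V js c5 f (grad_B w Jp) m L" and "A \<in> V"
  shows "is_search_direction \<Omega> V w Jp js S A d \<longleftrightarrow> d \<in> V \<and>
    (\<forall>v\<in>V. (LINT x|lebesgue_on \<Omega>. (S x *v curl \<Omega> d x) \<bullet> curl \<Omega> v x) = - variation \<Omega> (grad_B w Jp) js A v)"
proof -
  interpret E: convex_functional \<Omega> V js c5 f "grad_B w Jp" m L by (rule assms(1))
  have "(LINT x|lebesgue_on \<Omega>. js x \<bullet> v x - grad_B w Jp x (curl \<Omega> A x) \<bullet> curl \<Omega> v x)
      = - variation \<Omega> (grad_B w Jp) js A v" if "v \<in> V" for v
    unfolding variation_def using E.variation_integrable[OF assms(2) that] by simp
  then show ?thesis by (simp add: is_search_direction_def cong: ball_cong)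
qed

text \<open>Choosing \<open>q\<close> before the domain, the subspace, the density and the matrix
  fields expresses its dependence on the constants alone. Search directions are determined only up
  to null sets, so the iteration is a relation: one is shown to exist, and the estimates hold for
  every one.\<close>

theorem theorem2:
  fixes \<sigma> \<rho> c1 c2 c3 c4 c5 :: real
  assumes "0 < \<sigma>" and "\<sigma> < 1/2" and "0 < \<rho>" and "\<rho> < 1"
    and "0 < c1" and "c1 \<le> c2" and "0 < c3" and "c3 \<le> c4"
  shows "\<exists>q. 0 < q \<and> q < 1 \<and>
    (\<forall>(\<Omega> :: (real^3) set) (js :: real^3 \<Rightarrow> real^3) (V :: (real^3 \<Rightarrow> real^3) set)
       (w :: density) (Jp :: real^3 \<Rightarrow> real^3) (S :: nat \<Rightarrow> real^3 \<Rightarrow> real^3^3).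
      bounded_lipschitz_domain \<Omega> \<and>
      js \<in> L2_fields \<Omega> \<and>
      closed_subspace_H_curl \<Omega> V \<and>
      (\<forall>v\<in>V. L2_norm \<Omega> v \<le> c5 * L2_norm \<Omega> (curl \<Omega> v)) \<and>
      energy_density \<Omega> w Jp c1 c2 \<and>
      (\<forall>n. admissible_matrix_field \<Omega> c3 c4 (S n)) \<longrightarrow>
      (\<exists>A. is_minimizer (energy \<Omega> w Jp js) V A \<and>
        (\<forall>B. is_minimizer (energy \<Omega> w Jp js) V B \<longrightarrow> (AE x in lebesgue_on \<Omega>. B x = A x)) \<and>
        (\<forall>A0\<in>V.
          (\<exists>An. is_iteration \<Omega> V w Jp js S \<sigma> \<rho> A0 An) \<and>
          (\<forall>An. is_iteration \<Omega> V w Jp js S \<sigma> \<rho> A0 An \<longrightarrow>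
            (\<lambda>n. H_curl_norm \<Omega> (\<lambda>x. An n x - A x)) \<longlonglongrightarrow> 0 \<and>
            (\<exists>C>0. \<forall>n.
              L2_norm \<Omega> (curl \<Omega> (\<lambda>x. An n x - A x))
                \<le> C * q ^ n * L2_norm \<Omega> (curl \<Omega> (\<lambda>x. A0 x - A x)))))))"
proof -
  \<comment> \<open>The relative decrease of the energy gap in one step, with m = 1 / c2 and L = 1 /
    c1.\<close>
  define \<kappa> where "\<kappa> = 2 * (1 / c2) / c4 * (\<sigma> * min 1 (\<rho> * (2 * (1 - \<sigma>) * c3 / (1 / c1))))"
  \<comment> \<open>The maximum with 1/2 secures q > 0 without an upper bound on \<kappa>.\<close>
  define q where "q = sqrt (max (1 / 2) (1 - \<kappa>))"
  have "0 < \<kappa>" using assms by (simp add: \<kappa>_def)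
  then have q: "0 < q" "q < 1" by (auto simp: q_def less_max_iff_disj)
  have q2: "1 - \<kappa> \<le> q\<^sup>2" by (simp add: q_def le_max_iff_disj)
  show ?thesis
  proof (rule exI[of _ q], intro conjI allI impI q)
    fix \<Omega> js V w Jp and S :: "nat \<Rightarrow> real^3 \<Rightarrow> real^3^3"
    assume H: "bounded_lipschitz_domain \<Omega> \<and>
      js \<in> L2_fields \<Omega> \<and>
      closed_subspace_H_curl \<Omega> V \<and>
      (\<forall>v\<in>V. L2_norm \<Omega> v \<le> c5 * L2_norm \<Omega> (curl \<Omega> v)) \<and>
      energy_density \<Omega> w Jp c1 c2 \<and>
      (\<forall>n. admissible_matrix_field \<Omega> c3 c4 (S n))"
    have open_\<Omega>: "open \<Omega>" and "bounded \<Omega>" using H by (auto simp: bounded_lipschitz_domain_def)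
    then have lm: "\<Omega> \<in> lmeasurable" by (intro bounded_set_imp_lmeasurable) auto
    have S: "admissible_matrix_field \<Omega> c3 c4 (S n)" for n using H by blast
    let ?J = "energy \<Omega> w Jp js"
    let ?D = "variation \<Omega> (grad_B w Jp) js"
    interpret curl_space \<Omega> V js c5
      using H open_\<Omega> lm by unfold_locales auto
    interpret E: convex_functional \<Omega> V js c5 "\<lambda>x B. w x B (Jp x)" "grad_B w Jp" "1 / c2" "1 / c1"
      using H assms by unfold_locales (intro convex_density_energy lm, auto)
    note J = functional_energy[of \<Omega> w Jp js]
    note dir_iff = is_search_direction_iff[OF E.convex_functional_axioms]
    obtain A where A: "is_minimizer ?J V A"
      using E.minimizer_exists unfolding J by blast
    have AV: "A \<in> V" using A by (simp add: is_minimizer_def)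
    have step_V: "\<And>n. An n \<in> V" if it: "is_iteration \<Omega> V w Jp js S \<sigma> \<rho> A0 An" and "A0 \<in> V" for A0 An
    proof -
      fix n show "An n \<in> V"
      proof (induction n)
        case 0
        then show ?case using that by (simp add: is_iteration_def)
      next
        case (Suc n)
        obtain d \<alpha> where "is_search_direction \<Omega> V w Jp js (S n) (An n) d" "An (Suc n) = (\<lambda>x. An n x + \<alpha> *\<^sub>R d x)"
          using it unfolding is_iteration_def by blast
        with Suc show ?case by (simp add: V_add_scale is_search_direction_def)
      qed
    qed
    have "\<exists>An. is_iteration \<Omega> V w Jp js S \<sigma> \<rho> A0 An" if A0: "A0 \<in> V" for A0
    proof -
      \<comment> \<open>Choosing a direction for every step and every field turns the relation into
        a function that the recursion for \<open>An\<close> can iterate.\<close>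
      define \<delta> where "\<delta> n B = (SOME d. is_search_direction \<Omega> V w Jp js (S n) B d)" for n B
      have \<delta>: "is_search_direction \<Omega> V w Jp js (S n) B (\<delta> n B)" if B: "B \<in> V" for n B
      proof -
        have "\<exists>d. is_search_direction \<Omega> V w Jp js (S n) B d"
          unfolding dir_iff[OF B] using E.search_direction_exists[OF S assms(7,8) B, of n] by blast
        then show ?thesis unfolding \<delta>_def by (rule someI_ex)
      qed
      define next_iterate where "next_iterate n B x = B x +
        armijo_step \<sigma> \<rho> (\<lambda>\<alpha>. ?J (\<lambda>x. B x + \<alpha> *\<^sub>R \<delta> n B x)) *\<^sub>R \<delta> n B x" for n B x
      define An where "An = rec_nat A0 next_iterate"
      have V: "An n \<in> V" for n
      proof (induction n)
        case (Suc n)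
        then have "\<delta> n (An n) \<in> V" using \<delta> by (simp add: is_search_direction_def)
        with Suc show ?case unfolding An_def by (simp add: next_iterate_def[abs_def] V_add_scale)
      qed (simp add: An_def A0)
      have "An (Suc n) = next_iterate n (An n)" for n by (simp add: An_def)
      then have "is_iteration \<Omega> V w Jp js S \<sigma> \<rho> A0 An"
        unfolding is_iteration_def using \<delta>[OF V] by (auto simp: An_def next_iterate_def[abs_def])
      then show ?thesis by blast
    qed
    moreover have "(\<lambda>n. H_curl_norm \<Omega> (\<lambda>x. An n x - A x)) \<longlonglongrightarrow> 0 \<and>
        (\<exists>C>0. \<forall>n. curl_norm (\<lambda>x. An n x - A x) \<le> C * q ^ n * curl_norm (\<lambda>x. A0 x - A x))"
      if A0: "A0 \<in> V" and it: "is_iteration \<Omega> V w Jp js S \<sigma> \<rho> A0 An" for A0 An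
    proof -
      note V = step_V[OF it A0]
      have An0: "An 0 = A0" using it by (simp add: is_iteration_def)
      have step: "?J (An (Suc n)) - ?J A \<le> q\<^sup>2 * (?J (An n) - ?J A)" for n
      proof -
        obtain d where d: "is_search_direction \<Omega> V w Jp js (S n) (An n) d"
          and next_eq: "An (Suc n) = (\<lambda>x. An n x + armijo_step \<sigma> \<rho> (\<lambda>\<alpha>. ?J (\<lambda>x. An n x + \<alpha> *\<^sub>R d x)) *\<^sub>R d x)"
          using it unfolding is_iteration_def by blast
        have dV: "d \<in> V" and eq: "\<And>v. v \<in> V \<Longrightarrow>
            (LINT x|lebesgue_on \<Omega>. (S n x *v curl \<Omega> d x) \<bullet> curl \<Omega> v x) = - ?D (An n) v"
          using d dir_iff[OF V] by blast+
        have "?J (An (Suc n)) - ?J A \<le> (1 - \<kappa>) * (?J (An n) - ?J A)"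
          unfolding \<kappa>_def next_eq
          by (rule E.descent_step[unfolded J, OF S assms(7,8) _ assms(1) _ assms(3,4) V dV A eq])
             (use assms in auto)
        also have "\<dots> \<le> q\<^sup>2 * (?J (An n) - ?J A)"
          using q2 A V by (intro mult_right_mono) (auto simp: is_minimizer_def)
        finally show ?thesis .
      qed
      define C where "C = sqrt (1 / c1 / (1 / c2))"
      have C: "0 < C" using assms by (simp add: C_def)
      have rate: "curl_norm (\<lambda>x. An n x - A x) \<le> C * q ^ n * curl_norm (\<lambda>x. A0 x - A x)" for n
        unfolding C_def An0[symmetric] using assms q
        by (intro E.linear_convergence[unfolded J, where An=An, OF A V _ _ step]) auto
      have "(\<lambda>n. C * q ^ n * curl_norm (\<lambda>x. A0 x - A x)) \<longlonglongrightarrow> C * 0 * curl_norm (\<lambda>x. A0 x - A x)"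
        using q by (intro tendsto_intros LIMSEQ_realpow_zero) auto
      then have "(\<lambda>n. C * q ^ n * curl_norm (\<lambda>x. A0 x - A x)) \<longlonglongrightarrow> 0" by simp
      moreover have "\<forall>\<^sub>F n in sequentially. norm (curl_norm (\<lambda>x. An n x - A x)) \<le> C * q ^ n * curl_norm (\<lambda>x. A0 x - A x)"
        using rate by simp
      ultimately have "(\<lambda>n. curl_norm (\<lambda>x. An n x - A x)) \<longlonglongrightarrow> 0"
        by (rule Lim_null_comparison[rotated])
      then have "(\<lambda>n. H_curl_norm \<Omega> (\<lambda>x. An n x - A x)) \<longlonglongrightarrow> 0"
        by (rule H_curl_norm_tendsto_0[OF V_diff[OF V AV]])
      with C rate show ?thesis by blast
    qed
    ultimately show "\<exists>A. is_minimizer ?J V A \<and>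
        (\<forall>B. is_minimizer ?J V B \<longrightarrow> (AE x in lebesgue_on \<Omega>. B x = A x)) \<and>
        (\<forall>A0\<in>V.
          (\<exists>An. is_iteration \<Omega> V w Jp js S \<sigma> \<rho> A0 An) \<and>
          (\<forall>An. is_iteration \<Omega> V w Jp js S \<sigma> \<rho> A0 An \<longrightarrow>
            (\<lambda>n. H_curl_norm \<Omega> (\<lambda>x. An n x - A x)) \<longlonglongrightarrow> 0 \<and>
            (\<exists>C>0. \<forall>n. curl_norm (\<lambda>x. An n x - A x) \<le> C * q ^ n * curl_norm (\<lambda>x. A0 x - A x))))"
      using A E.minimizer_unique[unfolded J, OF A] by (intro exI[of _ A] conjI ballI allI impI) simp_all
  qed
qed

end
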